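(* There is no face-continuous space-filling curve whose construction is based on a reptiling of an acute triangle.
   Context: An $r$-gentiling of a triangle $T$ ($r\ge2$) is a subdivision of $T$ into $r$ triangles (tiles) with pairwise disjoint interiors, each similar to $T$; it is an $r$-reptiling if moreover all tiles are mutually congruent. A traversal order of $T$ is a map $f:[0,1)\to T$ whose image has closure $T$ and which is measure-preserving up to uniform scaling: for every interval $[x,y)\subseteq[0,1)$, the image $f([x,y))$ has area $(y-x)\cdot|T|$. Extend $f$ to $[0,1]$ by $f(1)=\lim_{x\uparrow 1}f(x)$; a (measure-preserving) space-filling curve is such a traversal order that is continuous. A space-filling curve $f$ with image $T$ is based on a gentiling if there is an infinite sequence of gentilings $\mathcal T_1,\mathcal T_2,\dots$ of $T$ such that (i) each $\mathcal T_{i+1}$ is obtained by subdividing each tile of $\mathcal T_i$ by a gentiling (of that tile), and (ii) $f$ traverses the tiles of each $\mathcal T_i$ one by one (each tile is the image of an interval, and these intervals are consecutive). It is based on a reptiling if additionally there is a natural number $r$ such that $\mathcal T_1$ and all the gentilings applied to the tiles of each $\mathcal T_i$ to obtain $\mathcal T_{i+1}$ are $r$-reptilings (not necessarily similar to each other). A space-filling curve $f$ is face-continuous if it is measure-preserving and the interior of the image under $f$ of any interval is a connected set. A triangle is acute if all its angles are less than $\pi/2$. *)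

theory Defs
  imports "HOL-Analysis.Analysis"
begin

type_synonym plane = "real^2"

definition vertex_angle :: "plane \<Rightarrow> plane \<Rightarrow> plane \<Rightarrow> real" where
  "vertex_angle a b c = arccos (((a - b) \<bullet> (c - b)) / (norm (a - b) * norm (c - b)))"
  (* the angle at b *)

definition is_triangle :: "plane set \<Rightarrow> bool" where
  "is_triangle T \<longleftrightarrow> (\<exists>a b c. \<not> collinear {a, b, c} \<and> T = convex hull {a, b, c})"

definition acute_triangle :: "plane set \<Rightarrow> bool" where
  "acute_triangle T \<longleftrightarrow>
     (\<exists>a b c. \<not> collinear {a, b, c} \<and> T = convex hull {a, b, c} \<and>
        vertex_angle b a c < pi / 2 \<and> vertex_angle a b c < pi / 2 \<and> vertex_angle a c b < pi / 2)"

(* Similarities and congruences may reverse orientation. *)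
definition similar :: "plane set \<Rightarrow> plane set \<Rightarrow> bool" where
  "similar A B \<longleftrightarrow>
     (\<exists>(h :: plane \<Rightarrow> plane) k. k > 0 \<and> (\<forall>x y. dist (h x) (h y) = k * dist x y) \<and> h ` A = B)"

definition congruent_sets :: "plane set \<Rightarrow> plane set \<Rightarrow> bool" where
  "congruent_sets A B \<longleftrightarrow>
     (\<exists>h :: plane \<Rightarrow> plane. (\<forall>x y. dist (h x) (h y) = dist x y) \<and> h ` A = B)"

definition gentiling :: "nat \<Rightarrow> plane set \<Rightarrow> plane set set \<Rightarrow> bool" where
  "gentiling r T \<T> \<longleftrightarrow>
     r \<ge> 2 \<and> is_triangle T \<and> finite \<T> \<and> card \<T> = r \<and> \<Union>\<T> = T \<and>
     (\<forall>t\<in>\<T>. is_triangle t \<and> similar T t) \<and>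
     (\<forall>s\<in>\<T>. \<forall>t\<in>\<T>. s \<noteq> t \<longrightarrow> interior s \<inter> interior t = {})"

definition reptiling :: "nat \<Rightarrow> plane set \<Rightarrow> plane set set \<Rightarrow> bool" where
  "reptiling r T \<T> \<longleftrightarrow> gentiling r T \<T> \<and> (\<forall>s\<in>\<T>. \<forall>t\<in>\<T>. congruent_sets s t)"

definition traversal_order :: "plane set \<Rightarrow> (real \<Rightarrow> plane) \<Rightarrow> bool" where
  "traversal_order T f \<longleftrightarrow>
     f ` {0..<1} \<subseteq> T \<and> closure (f ` {0..<1}) = T \<and>
     (\<forall>x y. 0 \<le> x \<and> x \<le> y \<and> y \<le> 1 \<longrightarrow>
        f ` {x..<y} \<in> lmeasurable \<and>
        measure lebesgue (f ` {x..<y}) = (y - x) * measure lebesgue T)"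

(* The limit condition says that f 1 is the extension of f from [0,1) to [0,1];
   values of f outside [0,1] are irrelevant. *)
definition space_filling_curve :: "plane set \<Rightarrow> (real \<Rightarrow> plane) \<Rightarrow> bool" where
  "space_filling_curve T f \<longleftrightarrow>
     traversal_order T f \<and> (f \<longlongrightarrow> f 1) (at_left 1) \<and> continuous_on {0..1} f"

(* The intervals are closed: the image of a half-open interval can miss the point
   at which the curve leaves a tile. *)
definition traverses_one_by_one :: "(real \<Rightarrow> plane) \<Rightarrow> plane set set \<Rightarrow> bool" where
  "traverses_one_by_one f \<T> \<longleftrightarrow>
     (\<exists>(a :: nat \<Rightarrow> real) (tile :: nat \<Rightarrow> plane set).
        a 0 = 0 \<and> a (card \<T>) = 1 \<and> strict_mono_on {..card \<T>} a \<and>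
        bij_betw tile {..<card \<T>} \<T> \<and>
        (\<forall>j<card \<T>. f ` {a j..a (Suc j)} = tile j))"

(* The sequence is indexed from 0, and G i t is the gentiling that subdivides
   the tile t of the i-th term. *)
definition gentiling_construction ::
  "plane set \<Rightarrow> (real \<Rightarrow> plane) \<Rightarrow> (nat \<Rightarrow> plane set set) \<Rightarrow>
   (nat \<Rightarrow> plane set \<Rightarrow> plane set set) \<Rightarrow> bool" where
  "gentiling_construction T f \<T> G \<longleftrightarrow>
     (\<forall>i. \<exists>r. gentiling r T (\<T> i)) \<and>
     (\<forall>i. \<forall>t\<in>\<T> i. \<exists>r. gentiling r t (G i t)) \<and>
     (\<forall>i. \<T> (Suc i) = (\<Union>t\<in>\<T> i. G i t)) \<and>
     (\<forall>i. traverses_one_by_one f (\<T> i))"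

definition based_on_gentiling :: "plane set \<Rightarrow> (real \<Rightarrow> plane) \<Rightarrow> bool" where
  "based_on_gentiling T f \<longleftrightarrow> (\<exists>\<T> G. gentiling_construction T f \<T> G)"

definition based_on_reptiling :: "plane set \<Rightarrow> (real \<Rightarrow> plane) \<Rightarrow> bool" where
  "based_on_reptiling T f \<longleftrightarrow>
     (\<exists>\<T> G r. gentiling_construction T f \<T> G \<and>
        reptiling r T (\<T> 0) \<and> (\<forall>i. \<forall>t\<in>\<T> i. reptiling r t (G i t)))"

(* All kinds of intervals (open, closed, half-open, degenerate) are included. *)
definition face_continuous :: "plane set \<Rightarrow> (real \<Rightarrow> plane) \<Rightarrow> bool" where
  "face_continuous T f \<longleftrightarrow>
     space_filling_curve T f \<and>
     (\<forall>I. is_interval I \<and> I \<subseteq> {0..1} \<longrightarrow> connected (interior (f ` I)))"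

end

theory Submission
  imports Defs
begin

text \<open>
  Call a vertex of a tile \<^emph>\<open>small\<close> if its angle is the smallest angle of the triangle, that is, if
  the opposite side has the smallest length. When a triangle is tiled by congruent triangles similar
  to it, exactly one tile covers a small vertex, and its side opposite to that vertex is a chord of the
  triangle of the smallest side length. Hence only one other tile can share more than isolated points
  with this corner tile, so by face-continuity the corner tile comes first or last. In the limit over
  the levels, the curve starts or ends in every tile at each of its small vertices.

  Now let \<open>s\<close> be the tile of the first level in a small corner of the whole triangle, say the last one,
  and let \<open>p\<close> be its predecessor. They share the chord \<open>PQ\<close>, and \<open>p\<close> must start at its vertex opposite
  to \<open>PQ\<close>. Since all angles are acute, the angles of \<open>s\<close> and \<open>p\<close> at each of \<open>P\<close> and \<open>Q\<close> add up to
  \<open>\<pi>\<close> minus the smallest angle, so at each of these points exactly one further tile fits, with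
  a small vertex there. The curve visits that vertex at an end of the tile, but neither \<open>s\<close> nor \<open>p\<close>
  can be its neighbour in the order, hence the whole curve starts there. So it starts both
  at \<open>P\<close> and at \<open>Q\<close>, a contradiction.
\<close>

section \<open>Areas of circular sectors\<close>

text \<open>The tilings need not be edge to edge, tiles may be mirror images of each other, and the
  triangle may be isosceles. Congruence makes up for this: no side of a tile is shorter than the
  chord cut off by the corner tile, so a tile bordering on that chord has exactly the chord as a
  side. In the isosceles case several vertices are small; the length of the opposite side identifies
  all of them. Acuteness enters twice. It gives \<open>2 * \<gamma> < half_disc_area\<close>, which
  settles the case that \<open>s\<close> and \<open>p\<close> are mirror images in the chord, so
  that both have the largest angle at the same end. It also gives
  \<open>c\<^sup>2 < a\<^sup>2 + b\<^sup>2\<close>; together with \<open>r \<ge> 2\<close>, that is,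
  a scale of at most \<open>1 / sqrt 2\<close>, this keeps \<open>P\<close> and \<open>Q\<close>
  strictly inside the sides of the whole triangle. Angles are read off from the areas cut out of
  small discs, so that angle sums at a point become sums of measures.\<close>

definition cross2 :: "plane \<Rightarrow> plane \<Rightarrow> real" where
  "cross2 u v = u$1 * v$2 - u$2 * v$1"

lemma cross2_simps [simp]:
  "cross2 u u = 0" "cross2 0 v = 0" "cross2 u 0 = 0"
  "cross2 (- u) v = - cross2 u v" "cross2 u (- v) = - cross2 u v"
  "cross2 (x *\<^sub>R u) v = x * cross2 u v" "cross2 u (x *\<^sub>R v) = x * cross2 u v"
  by (auto simp: cross2_def algebra_simps)

lemma cross2_add:
  "cross2 (u + u') v = cross2 u v + cross2 u' v" "cross2 u (v + v') = cross2 u v + cross2 u v'"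
  "cross2 (u - u') v = cross2 u v - cross2 u' v" "cross2 u (v - v') = cross2 u v - cross2 u v'"
  by (auto simp: cross2_def algebra_simps)

lemma cross2_commute: "cross2 u v = - cross2 v u"
  by (simp add: cross2_def)

lemma plane_eq_iff: "u = v \<longleftrightarrow> u$1 = v$1 \<and> u$2 = v$2" for u v :: plane
  by (simp add: vec_eq_iff forall_2)

lemma inner_plane: "u \<bullet> v = u$1 * v$1 + u$2 * v$2" for u v :: plane
  by (simp add: inner_vec_def sum_2)

text \<open>Cramer's rule for the basis \<open>u\<close>, \<open>w\<close>.\<close>

lemma cross2_coordinates:
  assumes "cross2 u w \<noteq> 0"
  shows "z = (cross2 z w / cross2 u w) *\<^sub>R u + (cross2 u z / cross2 u w) *\<^sub>R w"
  using assms by (simp add: plane_eq_iff field_simps) (simp add: cross2_def algebra_simps)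

lemma collinear_iff_cross2: "collinear {a, b, c} \<longleftrightarrow> cross2 (b - a) (c - a) = 0"
proof
  assume "collinear {a, b, c}"
  then obtain u where u: "\<And>x y. x \<in> {a,b,c} \<Longrightarrow> y \<in> {a,b,c} \<Longrightarrow> \<exists>k. x - y = k *\<^sub>R u"
    unfolding collinear_def by blast
  obtain k l where "b - a = k *\<^sub>R u" "c - a = l *\<^sub>R u"
    using u[of b a] u[of c a] by auto
  then show "cross2 (b - a) (c - a) = 0" by simp
next
  assume *: "cross2 (b - a) (c - a) = 0"
  show "collinear {a, b, c}"
  proof (cases "b = a")
    case False
    \<comment> \<open>The coefficient of the orthogonal projection of \<open>c - a\<close> to the
      line of \<open>b - a\<close>; the vanishing \<open>cross2\<close> makes the projection
      exact.\<close>
    define k where "k = ((c - a) \<bullet> (b - a)) / ((b - a) \<bullet> (b - a))"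
    have nz: "(b - a) \<bullet> (b - a) \<noteq> 0" using False by simp
    have "((b - a) \<bullet> (b - a)) *\<^sub>R (c - a) = ((c - a) \<bullet> (b - a)) *\<^sub>R (b - a)"
      using * unfolding plane_eq_iff inner_plane cross2_def
      by (simp; algebra)
    then have "c - a = k *\<^sub>R (b - a)"
      using nz unfolding k_def by (metis eq_vector_fraction_iff scaleR_scaleR divide_inverse_commute)
    then have "c = k *\<^sub>R b + (1 - k) *\<^sub>R a" by (simp add: algebra_simps)
    then have "collinear {b, c, a}" unfolding collinear_3_expand by blast
    then show ?thesis by (simp add: insert_commute)
  qed (simp add: collinear_2)
qed

section \<open>Sectors spanned by two vectors\<close>

definition sector :: "plane \<Rightarrow> plane \<Rightarrow> plane set" where
  "sector u v = {x *\<^sub>R u + y *\<^sub>R v | x y. 0 \<le> x \<and> 0 \<le> y}"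

lemma sectorI: "0 \<le> x \<Longrightarrow> 0 \<le> y \<Longrightarrow> x *\<^sub>R u + y *\<^sub>R v \<in> sector u v"
  by (auto simp: sector_def)

lemma sectorE:
  assumes "z \<in> sector u v"
  obtains x y where "z = x *\<^sub>R u + y *\<^sub>R v" "0 \<le> x" "0 \<le> y"
  using assms by (auto simp: sector_def)

lemma sector_commute: "sector u v = sector v u"
proof -
  have "sector u v \<subseteq> sector v u" for u v
  proof
    fix z assume "z \<in> sector u v"
    then obtain x y where z: "z = x *\<^sub>R u + y *\<^sub>R v" "0 \<le> x" "0 \<le> y" by (rule sectorE)
    show "z \<in> sector v u" using sectorI[OF z(3,2), of v u] by (simp add: z(1) add.commute)
  qed
  then show ?thesis by blast
qed

lemma sector_scaleR:
  assumes "0 < k" "0 < l"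
  shows "sector (k *\<^sub>R u) (l *\<^sub>R v) = sector u v"
proof (intro equalityI subsetI)
  fix z assume "z \<in> sector (k *\<^sub>R u) (l *\<^sub>R v)"
  then obtain x y where z: "z = x *\<^sub>R (k *\<^sub>R u) + y *\<^sub>R (l *\<^sub>R v)" "0 \<le> x" "0 \<le> y" by (rule sectorE)
  show "z \<in> sector u v" using sectorI[of "x * k" "y * l" u v] z assms by simp
next
  fix z assume "z \<in> sector u v"
  then obtain x y where z: "z = x *\<^sub>R u + y *\<^sub>R v" "0 \<le> x" "0 \<le> y" by (rule sectorE)
  show "z \<in> sector (k *\<^sub>R u) (l *\<^sub>R v)"
    using sectorI[of "x / k" "y / l" "k *\<^sub>R u" "l *\<^sub>R v"] z assms by simp
qed

lemma sector_iff:
  assumes "cross2 u w \<noteq> 0"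
  shows "z \<in> sector u w \<longleftrightarrow> 0 \<le> cross2 z w / cross2 u w \<and> 0 \<le> cross2 u z / cross2 u w"
proof
  assume "z \<in> sector u w"
  then obtain x y where "z = x *\<^sub>R u + y *\<^sub>R w" "0 \<le> x" "0 \<le> y" by (rule sectorE)
  then show "0 \<le> cross2 z w / cross2 u w \<and> 0 \<le> cross2 u z / cross2 u w"
    using assms by (simp add: cross2_add)
next
  assume "0 \<le> cross2 z w / cross2 u w \<and> 0 \<le> cross2 u z / cross2 u w"
  then show "z \<in> sector u w"
    by (subst cross2_coordinates[OF assms]) (auto intro!: sectorI)
qed

lemma convex_sector: "convex (sector u w)"
  unfolding convex_def
proof (intro ballI allI impI)
  fix z z' p q assume "z \<in> sector u w" "z' \<in> sector u w" and p: "0 \<le> p" "0 \<le> q" "p + q = (1::real)"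
  then obtain x y x' y' where "z = x *\<^sub>R u + y *\<^sub>R w" "0 \<le> x" "0 \<le> y"
    and "z' = x' *\<^sub>R u + y' *\<^sub>R w" "0 \<le> x'" "0 \<le> y'"
    by (auto elim!: sectorE)
  then show "p *\<^sub>R z + q *\<^sub>R z' \<in> sector u w"
    using p sectorI[of "p * x + q * x'" "p * y + q * y'" u w] by (simp add: algebra_simps)
qed

text \<open>
  Up to the factor 2 this is the angle between \<open>u\<close> and \<open>v\<close>. Measuring angles by areas reduces their
  additivity to that of the Lebesgue measure, without trigonometric functions.
\<close>

definition sector_area :: "plane \<Rightarrow> plane \<Rightarrow> real" where
  "sector_area u v = measure lebesgue (sector u v \<inter> ball 0 1)"

text \<open>The straight angle in the units of \<open>sector_area\<close>, hence also the angle sum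
  of a triangle.\<close>

definition half_disc_area :: real where
  "half_disc_area = measure lebesgue (ball (0::plane) 1) / 2"

lemma sector_lmeasurable: "sector u v \<inter> ball c r \<in> lmeasurable"
  by (auto intro!: measurable_convex convex_Int convex_sector)

lemma sector_area_commute: "sector_area u v = sector_area v u"
  by (simp add: sector_area_def sector_commute)

lemma sector_area_scaleR: "0 < k \<Longrightarrow> 0 < l \<Longrightarrow> sector_area (k *\<^sub>R u) (l *\<^sub>R v) = sector_area u v"
  by (simp add: sector_area_def sector_scaleR)

lemma sector_area_orthogonal:
  assumes "orthogonal_transformation L"
  shows "sector_area (L u) (L v) = sector_area u v"
proof -
  have lin: "linear L" using assms orthogonal_transformation_linear by blast
  have "sector (L u) (L v) = L ` sector u v"
  proof (intro equalityI subsetI)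
    fix z assume "z \<in> sector (L u) (L v)"
    then obtain x y where z: "z = x *\<^sub>R L u + y *\<^sub>R L v" "0 \<le> x" "0 \<le> y" by (rule sectorE)
    then have "z = L (x *\<^sub>R u + y *\<^sub>R v)" by (simp add: linear_add[OF lin] linear_cmul[OF lin])
    then show "z \<in> L ` sector u v" using sectorI[OF z(2,3)] by blast
  next
    fix z assume "z \<in> L ` sector u v"
    then obtain z' where "z' \<in> sector u v" "z = L z'" by blast
    then obtain x y where z: "z' = x *\<^sub>R u + y *\<^sub>R v" "0 \<le> x" "0 \<le> y" by (auto elim: sectorE)
    then show "z \<in> sector (L u) (L v)"
      using \<open>z = L z'\<close> sectorI[OF z(2,3)] by (simp add: linear_add[OF lin] linear_cmul[OF lin])
  qed
  moreover have "L ` ball 0 1 = ball 0 1"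
    using image_orthogonal_transformation_ball[OF assms, of 0 1] lin by (simp add: linear_0)
  moreover have "inj L" using assms orthogonal_transformation_inj by blast
  ultimately have "sector (L u) (L v) \<inter> ball 0 1 = L ` (sector u v \<inter> ball 0 1)"
    by (metis image_Int)
  then show ?thesis
    unfolding sector_area_def using measure_orthogonal_image[OF assms sector_lmeasurable] by simp
qed

lemma sector_area_minus: "sector_area (- u) (- v) = sector_area u v"
  by (rule sector_area_orthogonal) (simp add: orthogonal_transformation_def linear_uminus bounded_linear.linear)

lemma negligible_cross2:
  assumes "v \<noteq> 0"
  shows "negligible {z. cross2 v z = 0}"
proof -
  \<comment> \<open>A quarter turn of \<open>v\<close>; it makes \<open>cross2 v\<close> an inner
    product and its zero set a hyperplane.\<close>
  define a :: plane where "a = vector [- (v$2), v$1]"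
  have "a \<noteq> 0" using assms by (auto simp: a_def plane_eq_iff)
  moreover have "cross2 v z = a \<bullet> z" for z by (simp add: a_def cross2_def inner_plane)
  ultimately show ?thesis using negligible_hyperplane[of a 0] by simp
qed

lemma sector_split:
  assumes "0 < p" "0 < q"
  shows "sector u w = sector u (p *\<^sub>R u + q *\<^sub>R w) \<union> sector (p *\<^sub>R u + q *\<^sub>R w) w"
    (is "_ = sector u ?v \<union> sector ?v w")
proof (intro equalityI subsetI)
  fix z assume "z \<in> sector u w"
  then obtain x y where z: "z = x *\<^sub>R u + y *\<^sub>R w" "0 \<le> x" "0 \<le> y" by (rule sectorE)
  show "z \<in> sector u ?v \<union> sector ?v w"
  \<comment> \<open>The comparison tells on which side of the ray of \<open>?v\<close> the point
    lies.\<close>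
  proof (cases "y / q \<le> x / p")
    case True
    then have "0 \<le> x - y / q * p" using assms by (simp add: field_simps)
    then have "(x - y / q * p) *\<^sub>R u + (y / q) *\<^sub>R ?v \<in> sector u ?v"
      using z assms by (intro sectorI) auto
    also have "(x - y / q * p) *\<^sub>R u + (y / q) *\<^sub>R ?v = z"
      using assms by (simp add: z algebra_simps)
    finally show ?thesis by simp
  next
    case False
    then have "0 \<le> y - x / p * q" using assms by (simp add: field_simps)
    then have "(x / p) *\<^sub>R ?v + (y - x / p * q) *\<^sub>R w \<in> sector ?v w"
      using z assms by (intro sectorI) auto
    also have "(x / p) *\<^sub>R ?v + (y - x / p * q) *\<^sub>R w = z"
      using assms by (simp add: z algebra_simps)
    finally show ?thesis by simp
  qed
next
  fix z assume "z \<in> sector u ?v \<union> sector ?v w"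
  then show "z \<in> sector u w"
  proof
    assume "z \<in> sector u ?v"
    then obtain x y where z: "z = x *\<^sub>R u + y *\<^sub>R ?v" "0 \<le> x" "0 \<le> y" by (rule sectorE)
    have "z = (x + y * p) *\<^sub>R u + (y * q) *\<^sub>R w" by (simp add: z algebra_simps)
    then show ?thesis using z assms by (auto intro!: sectorI)
  next
    assume "z \<in> sector ?v w"
    then obtain x y where z: "z = x *\<^sub>R ?v + y *\<^sub>R w" "0 \<le> x" "0 \<le> y" by (rule sectorE)
    have "z = (x * p) *\<^sub>R u + (x * q + y) *\<^sub>R w" by (simp add: z algebra_simps)
    then show ?thesis using z assms by (auto intro!: sectorI)
  qed
qed

text \<open>Positive coefficients put the middle vector strictly between \<open>u\<close> and
  \<open>w\<close>. The two parts overlap only within its line, a null set.\<close>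

lemma sector_area_add:
  assumes "cross2 u w \<noteq> 0" "0 < p" "0 < q"
  shows "sector_area u w = sector_area u (p *\<^sub>R u + q *\<^sub>R w) + sector_area (p *\<^sub>R u + q *\<^sub>R w) w"
proof -
  define v where "v = p *\<^sub>R u + q *\<^sub>R w"
  have uv: "cross2 u v \<noteq> 0" "cross2 v w \<noteq> 0" using assms by (auto simp: v_def cross2_add)
  have "cross2 v z = 0" if zz: "z \<in> sector u v" "z \<in> sector v w" for z
  proof -
    obtain x y where z: "z = x *\<^sub>R u + y *\<^sub>R v" "0 \<le> x" "0 \<le> y" using zz(1) by (rule sectorE)
    obtain x' y' where z': "z = x' *\<^sub>R v + y' *\<^sub>R w" "0 \<le> x'" "0 \<le> y'" using zz(2) by (rule sectorE)
    have "cross2 v z = - x * q * cross2 u w"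
      using cross2_commute[of w u] by (simp add: z v_def cross2_add)
    moreover have "cross2 v z = y' * p * cross2 u w"
      by (simp add: z' v_def cross2_add)
    ultimately have "(x * q + y' * p) * cross2 u w = 0" by (simp add: algebra_simps)
    then have "x * q + y' * p = 0" using assms by simp
    moreover have "x * q \<ge> 0" "y' * p \<ge> 0" using z z' assms by auto
    ultimately have "x * q = 0" by linarith
    then show ?thesis using \<open>cross2 v z = - x * q * cross2 u w\<close> by simp
  qed
  then have "(sector u v \<inter> ball 0 1) \<inter> (sector v w \<inter> ball 0 1) \<subseteq> {z. cross2 v z = 0}" by auto
  moreover have "v \<noteq> 0" using uv by auto
  ultimately have "negligible ((sector u v \<inter> ball 0 1) \<inter> (sector v w \<inter> ball 0 1))"
    using negligible_subset[OF negligible_cross2] by blast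
  then have "measure lebesgue ((sector u v \<inter> ball 0 1) \<union> (sector v w \<inter> ball 0 1))
      = sector_area u v + sector_area v w"
    unfolding sector_area_def
    by (subst measure_Un3) (auto intro: sector_lmeasurable simp: negligible_imp_measure0)
  then show ?thesis
    using sector_split[OF assms(2,3), of u w] by (simp add: v_def sector_area_def Int_Un_distrib2)
qed

lemma measure_pos_open:
  assumes "open U" "U \<noteq> {}" "U \<subseteq> S" "S \<in> lmeasurable"
  shows "0 < measure lebesgue (S :: plane set)"
proof -
  have "\<not> negligible S" using assms(1-3) open_not_negligible negligible_subset by blast
  then have "measure lebesgue S \<noteq> 0" using assms(4) by (simp add: negligible_iff_measure0)
  then show ?thesis using measure_nonneg[of lebesgue S] by linarith
qed

lemma continuous_on_cross2 [continuous_intros]: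
  "continuous_on A f \<Longrightarrow> continuous_on A g \<Longrightarrow> continuous_on A (\<lambda>x. cross2 (f x) (g x))"
  unfolding cross2_def by (intro continuous_intros)

lemma sector_area_pos:
  assumes "cross2 u w \<noteq> 0"
  shows "0 < sector_area u w"
proof -
  define S where "S = {z. 0 < cross2 z w / cross2 u w} \<inter> {z. 0 < cross2 u z / cross2 u w} \<inter> ball 0 1"
  have "continuous_on UNIV (\<lambda>z. cross2 z w / cross2 u w)" "continuous_on UNIV (\<lambda>z. cross2 u z / cross2 u w)"
    using assms by (auto intro!: continuous_intros)
  then have "open S"
    unfolding S_def by (intro open_Int open_ball open_Collect_less continuous_on_const)
  moreover have "S \<noteq> {}"
  proof -
    \<comment> \<open>Shrinks \<open>u + w\<close>, a vector inside the sector, into the unit ball;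
      adding 1 to the norm keeps the denominator positive.\<close>
    define k where "k = 1 / (2 * (1 + norm (u + w)))"
    have k: "0 < k" unfolding k_def by (simp add: add_pos_nonneg)
    have less: "x / (2 * (1 + x)) < 1" if "0 \<le> x" for x :: real
    proof -
      have "0 < 2 * (1 + x)" "x < 2 * (1 + x)" using that by auto
      then show ?thesis by simp
    qed
    have "norm (k *\<^sub>R (u + w)) = norm (u + w) / (2 * (1 + norm (u + w)))"
      unfolding k_def by simp
    also have "\<dots> < 1" by (rule less) simp
    finally have "k *\<^sub>R (u + w) \<in> S"
      using assms k by (simp add: S_def cross2_add)
    then show ?thesis by auto
  qed
  moreover have "S \<subseteq> sector u w \<inter> ball 0 1"
  proof
    fix z assume "z \<in> S"
    then have "0 < cross2 z w / cross2 u w" "0 < cross2 u z / cross2 u w" "z \<in> ball 0 1"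
      unfolding S_def by blast+
    then show "z \<in> sector u w \<inter> ball 0 1"
      using sector_iff[OF assms, of z] by simp
  qed
  ultimately show ?thesis
    unfolding sector_area_def using sector_lmeasurable by (rule measure_pos_open)
qed

text \<open>The two sectors fill the half-plane on the side of \<open>w\<close> of the line of
  \<open>u\<close>. The point reflection at 0 exchanges it with the opposite half-plane, so each
  contains half of the disc.\<close>

lemma sector_area_half:
  assumes "cross2 u w \<noteq> 0"
  shows "sector_area u w + sector_area w (- u) = half_disc_area"
    and "measure lebesgue ((sector u w \<union> sector w (- u)) \<inter> ball 0 1) = half_disc_area"
    and "sector u w \<union> sector w (- u) = {z. 0 \<le> cross2 u z / cross2 u w}"
proof -
  define c where "c = cross2 u w"
  define A where "A = {z. 0 \<le> cross2 u z / c} \<inter> ball 0 1"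
  have u0: "u \<noteq> 0" using assms by auto
  have nz: "cross2 w (- u) = c" "c \<noteq> 0" using assms cross2_commute[of w u] by (auto simp: c_def)
  have cw: "cross2 z (- u) = cross2 u z" for z using cross2_commute[of z u] by simp
  have wc: "cross2 w z = - cross2 z w" for z by (rule cross2_commute)
  have 1: "z \<in> sector u w \<longleftrightarrow> 0 \<le> cross2 z w / c \<and> 0 \<le> cross2 u z / c"
    "z \<in> sector w (- u) \<longleftrightarrow> 0 \<le> cross2 u z / c \<and> 0 \<le> - (cross2 z w / c)" for z
    using sector_iff[OF assms, of z] sector_iff[of w "- u" z] nz cross2_commute[of z u] by (simp_all add: c_def[symmetric] cw wc)
  have A: "A = (sector u w \<inter> ball 0 1) \<union> (sector w (- u) \<inter> ball 0 1)"
    unfolding A_def set_eq_iff using 1 by (auto simp: linorder_class.not_le)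
  have "(sector u w \<inter> ball 0 1) \<inter> (sector w (- u) \<inter> ball 0 1) \<subseteq> {z. cross2 w z = 0}"
    using 1 nz by (auto simp: wc)
  moreover have "w \<noteq> 0" using assms by auto
  ultimately have "negligible ((sector u w \<inter> ball 0 1) \<inter> (sector w (- u) \<inter> ball 0 1))"
    using negligible_subset[OF negligible_cross2] by blast
  then have mA: "measure lebesgue A = sector_area u w + sector_area w (- u)"
    unfolding sector_area_def A
    by (subst measure_Un3) (auto intro: sector_lmeasurable simp: negligible_imp_measure0)
  have lA: "A \<in> lmeasurable" unfolding A by (intro fmeasurable.Un sector_lmeasurable)
  have orth: "orthogonal_transformation (uminus :: plane \<Rightarrow> plane)"
    by (simp add: orthogonal_transformation_def linear_uminus)
  define B where "B = uminus ` A"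
  have lB: "B \<in> lmeasurable" and mB: "measure lebesgue B = measure lebesgue A"
    using measurable_orthogonal_image[OF orth lA] measure_orthogonal_image[OF orth lA] by (auto simp: B_def)
  have B: "B = {z. cross2 u z / c \<le> 0} \<inter> ball 0 1"
  proof (intro equalityI subsetI)
    fix z assume "z \<in> B"
    then obtain z' where "z' \<in> A" "z = - z'" unfolding B_def by (rule imageE)
    then show "z \<in> {z. cross2 u z / c \<le> 0} \<inter> ball 0 1" by (simp add: A_def)
  next
    fix z assume "z \<in> {z. cross2 u z / c \<le> 0} \<inter> ball 0 1"
    then have "- z \<in> A" by (simp add: A_def)
    then have "- (- z) \<in> B" unfolding B_def by (rule imageI)
    then show "z \<in> B" by simp
  qed
  have "A \<inter> B \<subseteq> {z. cross2 u z = 0}"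
    using nz by (auto simp: A_def B)
  then have "negligible (A \<inter> B)"
    using negligible_subset[OF negligible_cross2[OF u0]] by blast
  then have "measure lebesgue (A \<union> B) = measure lebesgue A + measure lebesgue B"
    by (subst measure_Un3) (auto simp: lA lB negligible_imp_measure0)
  moreover have "A \<union> B = ball 0 1" by (auto simp: A_def B)
  ultimately have half: "measure lebesgue A = half_disc_area"
    unfolding half_disc_area_def using mB by simp
  then show "sector_area u w + sector_area w (- u) = half_disc_area" using mA by simp
  show "measure lebesgue ((sector u w \<union> sector w (- u)) \<inter> ball 0 1) = half_disc_area"
    using half by (simp add: A Int_Un_distrib2)
  show "sector u w \<union> sector w (- u) = {z. 0 \<le> cross2 u z / cross2 u w}"
    unfolding set_eq_iff Un_iff mem_Collect_eq 1 c_def[symmetric] by auto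
qed

text \<open>The triangle has the vertices 0, \<open>u\<close> and \<open>w\<close>. The exterior
  angle at 0, from \<open>w\<close> to \<open>- u\<close>, is split by the direction
  \<open>w - u\<close> of the opposite side into the alternate angles of the two other
  vertices.\<close>

lemma sector_area_triangle:
  assumes "cross2 u w \<noteq> 0"
  shows "sector_area u w + sector_area (- w) (u - w) + sector_area (- u) (w - u) = half_disc_area"
proof -
  have "cross2 w (- u) \<noteq> 0" using assms cross2_commute[of w u] by simp
  from sector_area_add[OF this, of 1 1]
  have "sector_area w (- u) = sector_area w (w - u) + sector_area (w - u) (- u)" by simp
  moreover have "sector_area w (w - u) = sector_area (- w) (u - w)"
    using sector_area_minus[of w "w - u"] by simp
  ultimately show ?thesis
    using sector_area_half(1)[OF assms] by (simp add: sector_area_commute)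
qed

text \<open>Reflection in the line through 0 orthogonal to \<open>d\<close>. For
  \<open>d = 0\<close> the division by zero makes it the identity, so it is orthogonal for every
  \<open>d\<close>.\<close>

definition reflect :: "plane \<Rightarrow> plane \<Rightarrow> plane" where
  "reflect d z = z - (2 * (z \<bullet> d) / (d \<bullet> d)) *\<^sub>R d"

lemma orthogonal_transformation_reflect: "orthogonal_transformation (reflect d)"
proof (cases "d = 0")
  case False
  have "linear (reflect d)"
    by (rule linearI) (auto simp: reflect_def algebra_simps inner_add_left add_divide_distrib)
  moreover have "reflect d v \<bullet> reflect d w = v \<bullet> w" for v w
    using False by (simp add: reflect_def inner_diff_left inner_diff_right inner_commute field_simps)
  ultimately show ?thesis by (simp add: orthogonal_transformation_def)
next
  case True
  then have "reflect d = (\<lambda>z. z)" by (auto simp: reflect_def)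
  then show ?thesis by (simp add: orthogonal_transformation_id)
qed

text \<open>Adding a positive multiple of \<open>d\<close> turns \<open>z\<close> towards
  \<open>d\<close>, which cuts off a sector of positive area.\<close>

lemma sector_area_shear:
  assumes "cross2 d z \<noteq> 0" "0 < t"
  shows "sector_area d (z + t *\<^sub>R d) < sector_area d z"
proof -
  have "z + t *\<^sub>R d = t *\<^sub>R d + 1 *\<^sub>R z" by simp
  then have "sector_area d z = sector_area d (z + t *\<^sub>R d) + sector_area (z + t *\<^sub>R d) z"
    using sector_area_add[OF assms(1,2), of 1] by (simp add: add.commute)
  moreover have "0 < sector_area (z + t *\<^sub>R d) z"
    by (rule sector_area_pos) (use assms in \<open>simp add: cross2_add\<close>)
  ultimately show ?thesis by simp
qed

text \<open>Reflection in the normal of \<open>u\<close> embeds the sector strictly into its complementary sector.\<close>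

lemma sector_area_acute:
  assumes "cross2 u w \<noteq> 0" "0 < u \<bullet> w"
  shows "2 * sector_area u w < half_disc_area"
proof -
  define t where "t = 2 * (u \<bullet> w) / (u \<bullet> u)"
  have "u \<noteq> 0" using assms by auto
  then have "0 < t" using assms by (simp add: t_def)
  have "reflect u u = - u" "reflect u w = w + t *\<^sub>R (- u)"
    using \<open>u \<noteq> 0\<close> by (simp_all add: reflect_def t_def inner_commute scaleR_2)
  then have "sector_area u w = sector_area (- u) (w + t *\<^sub>R (- u))"
    using sector_area_orthogonal[OF orthogonal_transformation_reflect, of u u w] by simp
  also have "\<dots> < sector_area (- u) w"
    by (rule sector_area_shear) (use assms \<open>0 < t\<close> in auto)
  finally show ?thesis using sector_area_half(1)[OF assms(1)] by (simp add: sector_area_commute)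
qed

text \<open>The apex is the first argument, whereas \<open>vertex_angle\<close> has it in the
  middle.\<close>

definition angle_area :: "plane \<Rightarrow> plane \<Rightarrow> plane \<Rightarrow> real" where
  "angle_area a b c = sector_area (b - a) (c - a)"

lemma angle_area_commute: "angle_area a b c = angle_area a c b"
  by (simp add: angle_area_def sector_area_commute)

text \<open>
  Reflecting in the perpendicular bisector of \<open>a b\<close> moves the angle at \<open>a\<close> to \<open>b\<close>, where it differs
  from the angle at \<open>b\<close> by a shear along \<open>a b\<close> whose sign compares the two opposite sides.
\<close>

lemma angle_area_opposite_side:
  fixes a b c :: plane
  defines "d \<equiv> a - b"
  assumes "\<not> collinear {a, b, c}"
  obtains t where "angle_area a b c = sector_area d ((c - b) + t *\<^sub>R d)"
    "angle_area b a c = sector_area d (c - b)" "t * (d \<bullet> d) = (dist a c)\<^sup>2 - (dist b c)\<^sup>2" "0 < d \<bullet> d"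
    "cross2 d (c - b) \<noteq> 0"
proof
  \<comment> \<open>Solves \<open>reflect d (c - a) = (c - b) + t *\<^sub>R d\<close>; the summand
    \<open>- 1\<close> comes from \<open>c - a = (c - b) - d\<close>.\<close>
  define t where "t = - 1 - 2 * ((c - a) \<bullet> d) / (d \<bullet> d)"
  have "a \<noteq> b" using assms by auto
  then show d: "0 < d \<bullet> d" by (simp add: d_def)
  have "reflect d (- d) = d" using d by (simp add: reflect_def scaleR_2)
  moreover have "reflect d (c - a) = (c - b) + t *\<^sub>R d"
    by (simp add: reflect_def t_def algebra_simps d_def)
  ultimately show "angle_area a b c = sector_area d ((c - b) + t *\<^sub>R d)"
    using sector_area_orthogonal[OF orthogonal_transformation_reflect, of d "- d" "c - a"]
    by (simp add: angle_area_def d_def)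
  show "angle_area b a c = sector_area d (c - b)" by (simp add: angle_area_def d_def)
  have "t * (d \<bullet> d) = - (d \<bullet> d) - 2 * ((c - a) \<bullet> d)" using d by (simp add: t_def field_simps)
  also have "\<dots> = (dist a c)\<^sup>2 - (dist b c)\<^sup>2"
    by (simp add: d_def dist_norm power2_norm_eq_inner algebra_simps inner_commute)
  finally show "t * (d \<bullet> d) = (dist a c)\<^sup>2 - (dist b c)\<^sup>2" .
  have "cross2 d (c - b) = - cross2 (b - a) (c - a)" by (simp add: d_def cross2_def algebra_simps)
  then show "cross2 d (c - b) \<noteq> 0" using assms collinear_iff_cross2 by simp
qed

text \<open>The longer side makes the shear parameter positive, and such a shear narrows the
  sector.\<close>

lemma angle_area_less:
  assumes "\<not> collinear {a, b, c}" "dist b c < dist a c"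
  shows "angle_area a b c < angle_area b a c"
proof -
  obtain t where t: "angle_area a b c = sector_area (a - b) ((c - b) + t *\<^sub>R (a - b))"
    "angle_area b a c = sector_area (a - b) (c - b)"
    "t * ((a - b) \<bullet> (a - b)) = (dist a c)\<^sup>2 - (dist b c)\<^sup>2" "0 < (a - b) \<bullet> (a - b)"
    "cross2 (a - b) (c - b) \<noteq> 0"
    using angle_area_opposite_side[OF assms(1)] .
  have "(dist b c)\<^sup>2 < (dist a c)\<^sup>2" using assms(2) by (simp add: power_strict_mono)
  then have "0 < t" using t(3,4) by (metis diff_gt_0_iff_gt zero_less_mult_pos2)
  then show ?thesis using sector_area_shear[OF t(5)] t(1,2) by simp
qed

lemma angle_area_eq:
  assumes "\<not> collinear {a, b, c}" "dist b c = dist a c"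
  shows "angle_area a b c = angle_area b a c"
proof -
  obtain t where t: "angle_area a b c = sector_area (a - b) ((c - b) + t *\<^sub>R (a - b))"
    "angle_area b a c = sector_area (a - b) (c - b)"
    "t * ((a - b) \<bullet> (a - b)) = (dist a c)\<^sup>2 - (dist b c)\<^sup>2" "0 < (a - b) \<bullet> (a - b)"
    "cross2 (a - b) (c - b) \<noteq> 0"
    using angle_area_opposite_side[OF assms(1)] .
  then have "t = 0" using assms(2) by simp
  then show ?thesis using t(1,2) by simp
qed

lemma angle_area_sum:
  assumes "\<not> collinear {a, b, c}"
  shows "angle_area a b c + angle_area b a c + angle_area c a b = half_disc_area"
  using sector_area_triangle[of "b - a" "c - a"] assms
  by (simp add: collinear_iff_cross2 angle_area_def sector_area_commute algebra_simps)

section \<open>Similarities and local angles\<close>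

definition similarity :: "real \<Rightarrow> (plane \<Rightarrow> plane) \<Rightarrow> bool" where
  "similarity k h \<longleftrightarrow> 0 < k \<and> (\<forall>x y. dist (h x) (h y) = k * dist x y)"

lemma similarity_linear:
  assumes "similarity k h"
  obtains L where "orthogonal_transformation L" "h = (\<lambda>x. k *\<^sub>R L x + h 0)"
proof
  define L where "L x = (1 / k) *\<^sub>R (h x - h 0)" for x
  have k: "0 < k" "dist (h x) (h y) = k * dist x y" for x y using assms by (auto simp: similarity_def)
  have "dist (L x) (L y) = dist x y" for x y
  proof -
    have "L x - L y = (1 / k) *\<^sub>R (h x - h y)" by (simp add: L_def algebra_simps)
    then show ?thesis using k by (simp add: dist_norm)
  qed
  then show "orthogonal_transformation L"
    by (simp add: orthogonal_transformation_isometry L_def)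
  show "h = (\<lambda>x. k *\<^sub>R L x + h 0)" using k by (auto simp: L_def)
qed

lemma similarity_compose:
  "similarity k h \<Longrightarrow> similarity l g \<Longrightarrow> similarity (k * l) (\<lambda>x. h (g x))"
  by (simp add: similarity_def)

lemma similarity_id: "similarity 1 (\<lambda>x. x)"
  by (simp add: similarity_def)

lemma similarity_convex_hull:
  assumes "similarity k h"
  shows "h ` (convex hull S) = convex hull (h ` S)"
proof -
  obtain L where L: "orthogonal_transformation L" "h = (\<lambda>x. k *\<^sub>R L x + h 0)"
    using similarity_linear[OF assms] .
  have lin: "linear (\<lambda>x. k *\<^sub>R L x)"
    using L(1) by (intro linear_compose_scale_right) (rule orthogonal_transformation_linear)
  have h: "h ` S = (+) (h 0) ` (\<lambda>x. k *\<^sub>R L x) ` S" for S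
    by (subst L(2)) (simp add: image_image add.commute)
  show ?thesis
    unfolding h convex_hull_linear_image[OF lin] convex_hull_translation ..
qed

lemma similarity_measure:
  assumes "similarity k h" "S \<in> lmeasurable"
  shows "measure lebesgue (h ` S) = k\<^sup>2 * measure lebesgue S"
proof -
  obtain L where L: "orthogonal_transformation L" "h = (\<lambda>x. k *\<^sub>R L x + h 0)"
    using similarity_linear[OF assms(1)] .
  have "h ` S = (\<lambda>x. k *\<^sub>R x + h 0) ` (L ` S)"
    by (subst L(2)) (simp add: image_image)
  then have "measure lebesgue (h ` S) = \<bar>k\<bar> ^ DIM(plane) * measure lebesgue (L ` S)"
    using measure_lebesgue_affine by metis
  then show ?thesis using measure_orthogonal_image[OF L(1) assms(2)] by simp
qed

lemma angle_area_similarity: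
  assumes "similarity k h"
  shows "angle_area (h a) (h b) (h c) = angle_area a b c"
proof -
  obtain L where L: "orthogonal_transformation L" "h = (\<lambda>x. k *\<^sub>R L x + h 0)"
    using similarity_linear[OF assms] .
  have diff: "h x - h y = k *\<^sub>R L (x - y)" for x y
    by (subst (1 2) L(2)) (simp add: linear_diff[OF orthogonal_transformation_linear[OF L(1)]] scaleR_diff_right)
  have "0 < k" using assms by (simp add: similarity_def)
  then show ?thesis
    unfolding angle_area_def diff by (simp add: sector_area_scaleR sector_area_orthogonal[OF L(1)])
qed

text \<open>Lagrange's identity. It bounds \<open>cross2\<close> by the product of the norms and
  shows that orthogonal maps preserve it up to sign.\<close>

lemma cross2_square: "(cross2 u v)\<^sup>2 = (norm u)\<^sup>2 * (norm v)\<^sup>2 - (u \<bullet> v)\<^sup>2"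
  unfolding power2_norm_eq_inner inner_plane cross2_def by (simp add: power2_eq_square) algebra

lemma abs_cross2_le: "\<bar>cross2 u v\<bar> \<le> norm u * norm v"
proof (rule power2_le_imp_le)
  show "\<bar>cross2 u v\<bar>\<^sup>2 \<le> (norm u * norm v)\<^sup>2"
    using cross2_square[of u v] by (simp add: power_mult_distrib)
qed simp

lemma collinear_similarity:
  assumes "similarity k h" "\<not> collinear {a, b, c}"
  shows "\<not> collinear {h a, h b, h c}"
proof -
  obtain L where L: "orthogonal_transformation L" "h = (\<lambda>x. k *\<^sub>R L x + h 0)"
    using similarity_linear[OF assms(1)] .
  have diff: "h x - h y = k *\<^sub>R L (x - y)" for x y
    by (subst (1 2) L(2)) (simp add: linear_diff[OF orthogonal_transformation_linear[OF L(1)]] scaleR_diff_right)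
  have "(cross2 (L u) (L v))\<^sup>2 = (cross2 u v)\<^sup>2" for u v
    unfolding cross2_square using L(1) by (simp add: orthogonal_transformation_norm orthogonal_transformation_def)
  then have "cross2 (L u) (L v) \<noteq> 0" if "cross2 u v \<noteq> 0" for u v
    using that by (metis zero_eq_power2)
  moreover have "0 < k" using assms(1) by (simp add: similarity_def)
  ultimately show ?thesis using assms(2) by (simp add: collinear_iff_cross2 diff)
qed

section \<open>Triangles in affine coordinates\<close>

lemma convex_hull_3_iff:
  "z \<in> convex hull {a, b, c} \<longleftrightarrow>
    (\<exists>x y. z = a + x *\<^sub>R (b - a) + y *\<^sub>R (c - a) \<and> 0 \<le> x \<and> 0 \<le> y \<and> x + y \<le> 1)"
  unfolding convex_hull_3_alt by blast

lemma interior_triangle_iff: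
  assumes "\<not> collinear {a, b, c :: plane}"
  shows "z \<in> interior (convex hull {a, b, c}) \<longleftrightarrow>
    (\<exists>x y. z = a + x *\<^sub>R (b - a) + y *\<^sub>R (c - a) \<and> 0 < x \<and> 0 < y \<and> x + y < 1)"
proof -
  have "interior (convex hull {a, b, c}) =
    {v. \<exists>x y z. 0 < x \<and> 0 < y \<and> 0 < z \<and> x + y + z = 1 \<and> x *\<^sub>R a + y *\<^sub>R b + z *\<^sub>R c = v}"
    by (rule interior_convex_hull_3_minimal) (use assms in auto)
  then have "z \<in> interior (convex hull {a, b, c}) \<longleftrightarrow>
     (\<exists>p x y. 0 < p \<and> 0 < x \<and> 0 < y \<and> p + x + y = 1 \<and> p *\<^sub>R a + x *\<^sub>R b + y *\<^sub>R c = z)" by blast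
  also have "\<dots> \<longleftrightarrow> (\<exists>x y. z = a + x *\<^sub>R (b - a) + y *\<^sub>R (c - a) \<and> 0 < x \<and> 0 < y \<and> x + y < 1)"
  proof
    assume "\<exists>p x y. 0 < p \<and> 0 < x \<and> 0 < y \<and> p + x + y = 1 \<and> p *\<^sub>R a + x *\<^sub>R b + y *\<^sub>R c = z"
    then obtain p x y where *: "0 < p" "0 < x" "0 < y" "p + x + y = 1" "p *\<^sub>R a + x *\<^sub>R b + y *\<^sub>R c = z"
      by blast
    then have p: "p = 1 - x - y" by simp
    have "z = a + x *\<^sub>R (b - a) + y *\<^sub>R (c - a)"
      unfolding *(5)[symmetric] p by (simp add: algebra_simps)
    then show "\<exists>x y. z = a + x *\<^sub>R (b - a) + y *\<^sub>R (c - a) \<and> 0 < x \<and> 0 < y \<and> x + y < 1"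
      using * p by (intro exI[of _ x] exI[of _ y]) simp
  next
    assume "\<exists>x y. z = a + x *\<^sub>R (b - a) + y *\<^sub>R (c - a) \<and> 0 < x \<and> 0 < y \<and> x + y < 1"
    then obtain x y where *: "z = a + x *\<^sub>R (b - a) + y *\<^sub>R (c - a)" "0 < x" "0 < y" "x + y < 1" by blast
    have "(1 - x - y) *\<^sub>R a + x *\<^sub>R b + y *\<^sub>R c = z" unfolding *(1) by (simp add: algebra_simps)
    then show "\<exists>p x y. 0 < p \<and> 0 < x \<and> 0 < y \<and> p + x + y = 1 \<and> p *\<^sub>R a + x *\<^sub>R b + y *\<^sub>R c = z"
      using * by (intro exI[of _ "1 - x - y"] exI[of _ x] exI[of _ y]) simp
  qed
  finally show ?thesis .
qed

lemma extreme_point_of_triangle: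
  assumes "\<not> collinear {x, y, z :: plane}"
  shows "x extreme_point_of (convex hull {x, y, z})"
proof -
  have "\<not> affine_dependent {x, y, z}" using assms by (simp add: collinear_3_eq_affine_dependent)
  then show ?thesis by (simp add: extreme_point_of_convex_hull_affine_independent)
qed

text \<open>Equality is required for all small radii and not only in the limit, because a polygon
  coincides with a cone near each of its points. The value is half the angle in radians.\<close>

definition has_angle :: "plane set \<Rightarrow> plane \<Rightarrow> real \<Rightarrow> bool" where
  "has_angle S p t \<longleftrightarrow> (\<forall>\<^sub>F r in at_right 0. measure lebesgue (S \<inter> ball p r) = t * r\<^sup>2)"

text \<open>Serves for tiles that contain \<open>p\<close> other than as a vertex: a lower bound
  treats points inside a side and interior points alike.\<close>

definition angle_at_least :: "plane set \<Rightarrow> plane \<Rightarrow> real \<Rightarrow> bool" where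
  "angle_at_least S p t \<longleftrightarrow> (\<forall>\<^sub>F r in at_right 0. t * r\<^sup>2 \<le> measure lebesgue (S \<inter> ball p r))"

lemma has_angle_imp_at_least: "has_angle S p t \<Longrightarrow> angle_at_least S p t"
  unfolding has_angle_def angle_at_least_def by (erule eventually_mono) simp

lemma has_angle_outside:
  assumes "closed S" "p \<notin> S"
  shows "has_angle S p 0"
proof -
  have "open (- S)" "p \<in> - S" using assms by auto
  then obtain e where "0 < e" "ball p e \<subseteq> - S" by (rule openE)
  then have "measure lebesgue (S \<inter> ball p r) = 0 * r\<^sup>2" if "0 < r" "r < e" for r
  proof -
    have "ball p r \<subseteq> ball p e" using that by (simp add: subset_ball)
    then have "S \<inter> ball p r = {}" using \<open>ball p e \<subseteq> - S\<close> by blast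
    then show ?thesis by simp
  qed
  then show ?thesis
    unfolding has_angle_def eventually_at_right_field using \<open>0 < e\<close> by blast
qed

lemma has_angle_unique:
  assumes "has_angle S p x" "has_angle S p y"
  shows "x = y"
proof -
  have "\<forall>\<^sub>F r in at_right (0::real). x = y"
    using assms[unfolded has_angle_def] eventually_at_right_less[of 0]
    by eventually_elim auto
  then show ?thesis by simp
qed

text \<open>Two convex sets with disjoint interiors meet in a convex set without interior points,
  which is a null set.\<close>

lemma measure_Union_Int_interior_disjoint:
  fixes F :: "plane set set"
  assumes "finite F" "\<And>q. q \<in> F \<Longrightarrow> convex q"
    "\<And>q q'. q \<in> F \<Longrightarrow> q' \<in> F \<Longrightarrow> q \<noteq> q' \<Longrightarrow> interior q \<inter> interior q' = {}"
    "convex D" "bounded D"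
  shows "measure lebesgue (\<Union>F \<inter> D) = (\<Sum>q\<in>F. measure lebesgue (q \<inter> D))"
proof -
  have "\<Union>F \<inter> D = (\<Union>q\<in>F. q \<inter> D)" by blast
  moreover have "measure lebesgue (\<Union>q\<in>F. q \<inter> D) = (\<Sum>q\<in>F. measure lebesgue (q \<inter> D))"
  proof (rule measure_negligible_finite_Union_image[OF assms(1)])
    show "q \<inter> D \<in> lmeasurable" if "q \<in> F" for q
      using assms(2)[OF that] assms(4,5) by (intro measurable_convex convex_Int) (auto intro: bounded_Int)
    show "pairwise (\<lambda>q q'. negligible ((q \<inter> D) \<inter> (q' \<inter> D))) F"
    proof (rule pairwiseI)
      fix q q' assume q: "q \<in> F" "q' \<in> F" "q \<noteq> q'"
      have "interior (q \<inter> q') = {}" using assms(3)[OF q] by simp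
      then have "negligible (q \<inter> q')"
        using negligible_convex_interior[of "q \<inter> q'"] assms(2) q by (simp add: convex_Int)
      then show "negligible ((q \<inter> D) \<inter> (q' \<inter> D))"
        by (rule negligible_subset) blast
    qed
  qed
  ultimately show ?thesis by simp
qed

text \<open>Finitely many conditions on small radii hold for a common radius. There the areas add
  up, and dividing by the square of the radius leaves the angles.\<close>

lemma has_angle_sum:
  assumes "finite F" "has_angle (\<Union>F) p t"
    and "\<And>q. q \<in> F \<Longrightarrow> convex q" "\<And>q q'. q \<in> F \<Longrightarrow> q' \<in> F \<Longrightarrow> q \<noteq> q' \<Longrightarrow> interior q \<inter> interior q' = {}"
  shows "(\<And>q. q \<in> F \<Longrightarrow> has_angle q p (f q)) \<Longrightarrow> sum f F = t"
    and "(\<And>q. q \<in> F \<Longrightarrow> angle_at_least q p (f q)) \<Longrightarrow> sum f F \<le> t"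
proof -
  have sum: "measure lebesgue (\<Union>F \<inter> ball p r) = (\<Sum>q\<in>F. measure lebesgue (q \<inter> ball p r))" for r
    using assms(1,3,4) by (intro measure_Union_Int_interior_disjoint) auto
  have T: "\<forall>\<^sub>F r in at_right 0. measure lebesgue (\<Union>F \<inter> ball p r) = t * r\<^sup>2 \<and> 0 < r"
    using assms(2) unfolding has_angle_def
    by (intro eventually_conj eventually_at_right_less)
  show "sum f F = t" if "\<And>q. q \<in> F \<Longrightarrow> has_angle q p (f q)"
  proof -
    have "\<forall>\<^sub>F r in at_right 0. \<forall>q\<in>F. measure lebesgue (q \<inter> ball p r) = f q * r\<^sup>2"
      using that unfolding has_angle_def by (intro eventually_ball_finite assms(1)) auto
    then have "\<forall>\<^sub>F r in at_right (0::real). sum f F = t"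
      using T
    proof eventually_elim
      case (elim r)
      then have "(\<Sum>q\<in>F. f q * r\<^sup>2) = t * r\<^sup>2" using sum[of r] by simp
      then have "sum f F * r\<^sup>2 = t * r\<^sup>2" by (simp add: sum_distrib_right)
      then show ?case using elim by simp
    qed
    then show ?thesis by simp
  qed
  show "sum f F \<le> t" if "\<And>q. q \<in> F \<Longrightarrow> angle_at_least q p (f q)"
  proof -
    have "\<forall>\<^sub>F r in at_right 0. \<forall>q\<in>F. f q * r\<^sup>2 \<le> measure lebesgue (q \<inter> ball p r)"
      using that unfolding angle_at_least_def by (intro eventually_ball_finite assms(1)) auto
    then have "\<forall>\<^sub>F r in at_right (0::real). sum f F \<le> t"
      using T
    proof eventually_elim
      case (elim r)
      then have "(\<Sum>q\<in>F. f q * r\<^sup>2) \<le> (\<Sum>q\<in>F. measure lebesgue (q \<inter> ball p r))"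
        by (intro sum_mono) auto
      then have "(\<Sum>q\<in>F. f q * r\<^sup>2) \<le> t * r\<^sup>2" using sum[of r] elim by simp
      then have "sum f F * r\<^sup>2 \<le> t * r\<^sup>2" by (simp add: sum_distrib_right)
      then show ?case using elim by simp
    qed
    then show ?thesis by simp
  qed
qed

lemma measure_cone_scale:
  fixes K :: "plane set"
  assumes "\<And>z x. z \<in> K \<Longrightarrow> 0 < x \<Longrightarrow> x *\<^sub>R z \<in> K" "0 < r"
  shows "measure lebesgue ((+) p ` (K \<inter> ball 0 r)) = measure lebesgue (K \<inter> ball 0 1) * r\<^sup>2"
proof -
  have "K \<inter> ball 0 r = (\<lambda>z. r *\<^sub>R z + 0) ` (K \<inter> ball 0 1)"
  proof (intro equalityI subsetI)
    fix z assume z: "z \<in> K \<inter> ball 0 r"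
    then have "(1 / r) *\<^sub>R z \<in> K \<inter> ball 0 1" using assms by auto
    then have "r *\<^sub>R ((1 / r) *\<^sub>R z) + 0 \<in> (\<lambda>z. r *\<^sub>R z + 0) ` (K \<inter> ball 0 1)" by (rule imageI)
    then show "z \<in> (\<lambda>z. r *\<^sub>R z + 0) ` (K \<inter> ball 0 1)" using assms by simp
  next
    fix z assume "z \<in> (\<lambda>z. r *\<^sub>R z + 0) ` (K \<inter> ball 0 1)"
    then obtain z' where "z = r *\<^sub>R z' + 0" "z' \<in> K" "z' \<in> ball 0 1" by blast
    then show "z \<in> K \<inter> ball 0 r" using assms by simp
  qed
  then have "measure lebesgue (K \<inter> ball 0 r) = \<bar>r\<bar> ^ DIM(plane) * measure lebesgue (K \<inter> ball 0 1)"
    using measure_lebesgue_affine[of r 0 "K \<inter> ball 0 1"] by simp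
  then show ?thesis by (simp add: measure_translation)
qed

lemma sector_cone: "z \<in> sector u w \<Longrightarrow> 0 < x \<Longrightarrow> x *\<^sub>R z \<in> sector u w"
  by (erule sectorE) (simp add: scaleR_add_right, rule sectorI, auto)

lemma measure_sector_scale:
  "0 < r \<Longrightarrow> measure lebesgue ((+) p ` (sector u w \<inter> ball 0 r)) = sector_area u w * r\<^sup>2"
  unfolding sector_area_def by (rule measure_cone_scale) (auto intro: sector_cone)

lemma measure_half_disc_scale:
  assumes "cross2 u w \<noteq> 0" "0 < r"
  shows "measure lebesgue ((+) p ` ((sector u w \<union> sector w (- u)) \<inter> ball 0 r)) = half_disc_area * r\<^sup>2"
  unfolding sector_area_half(2)[OF assms(1), symmetric]
  by (rule measure_cone_scale) (use assms in \<open>auto intro: sector_cone\<close>)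

lemma triangle_near_vertex:
  assumes "\<not> collinear {a, b, c :: plane}"
  obtains e where "0 < e"
    "\<And>r. r \<le> e \<Longrightarrow> convex hull {a, b, c} \<inter> ball a r = (+) a ` (sector (b - a) (c - a) \<inter> ball 0 r)"
proof
  define u w where "u = b - a" and "w = c - a"
  define d where "d = cross2 u w"
  have d: "d \<noteq> 0" using assms by (simp add: collinear_iff_cross2 d_def u_def w_def)
  then have n: "0 < norm u" "0 < norm w" by (auto simp: d_def)
  \<comment> \<open>If \<open>v = x *\<^sub>R u + y *\<^sub>R w\<close> then
    \<open>x * \<bar>d\<bar>\<close> and \<open>y * \<bar>d\<bar>\<close> are at most
    \<open>norm v\<close> times \<open>norm w\<close> and \<open>norm u\<close>; hence
    \<open>norm v < e\<close> forces \<open>x + y \<le> 1\<close>.\<close>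
  define e where "e = \<bar>d\<bar> / (norm u + norm w)"
  show "0 < e" unfolding e_def using d n by (intro divide_pos_pos add_pos_pos) auto
  fix r assume r: "r \<le> e"
  show "convex hull {a, b, c} \<inter> ball a r = (+) a ` (sector (b - a) (c - a) \<inter> ball 0 r)"
    unfolding u_def[symmetric] w_def[symmetric]
  proof (intro equalityI subsetI)
    fix z assume z: "z \<in> convex hull {a, b, c} \<inter> ball a r"
    then obtain x y where *: "z = a + x *\<^sub>R u + y *\<^sub>R w" "0 \<le> x" "0 \<le> y"
      using convex_hull_3_iff[of z] by (auto simp: u_def w_def)
    then have "z = a + (x *\<^sub>R u + y *\<^sub>R w)" by simp
    moreover have "x *\<^sub>R u + y *\<^sub>R w \<in> sector u w" using * by (intro sectorI)
    moreover have "x *\<^sub>R u + y *\<^sub>R w \<in> ball 0 r"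
    proof -
      have "a - z = - (x *\<^sub>R u + y *\<^sub>R w)" using * by simp
      then have "norm (a - z) = norm (x *\<^sub>R u + y *\<^sub>R w)" by (metis norm_minus_cancel)
      moreover have "norm (a - z) < r" using z by (simp add: dist_norm)
      ultimately show ?thesis unfolding mem_ball_0 by simp
    qed
    ultimately show "z \<in> (+) a ` (sector u w \<inter> ball 0 r)" by blast
  next
    fix z assume "z \<in> (+) a ` (sector u w \<inter> ball 0 r)"
    then obtain v where v: "z = a + v" "v \<in> sector u w" "norm v < r" by auto
    obtain x y where xy: "v = x *\<^sub>R u + y *\<^sub>R w" "0 \<le> x" "0 \<le> y" using v(2) by (rule sectorE)
    have "cross2 v w = x * d" "cross2 u v = y * d" by (simp_all add: xy cross2_add d_def)
    then have "x * \<bar>d\<bar> \<le> norm v * norm w" "y * \<bar>d\<bar> \<le> norm u * norm v"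
      using abs_cross2_le[of v w] abs_cross2_le[of u v] xy by (simp_all add: abs_mult)
    then have "(x + y) * \<bar>d\<bar> \<le> norm v * (norm u + norm w)" by (simp add: algebra_simps)
    also have "\<dots> \<le> e * (norm u + norm w)" using v(3) r n by (intro mult_right_mono) auto
    also have "\<dots> = 1 * \<bar>d\<bar>" using n add_pos_pos[OF n] by (simp add: e_def)
    finally have "x + y \<le> 1" using d by (simp only: mult_le_cancel_right)
    then have "z \<in> convex hull {a, b, c}"
      using convex_hull_3_iff[of z] xy v(1) by (auto simp: u_def w_def add.assoc)
    moreover have "z \<in> ball a r" using v by (simp add: dist_norm)
    ultimately show "z \<in> convex hull {a, b, c} \<inter> ball a r" by blast
  qed
qed

lemma has_angle_vertex:
  assumes "\<not> collinear {a, b, c :: plane}"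
  shows "has_angle (convex hull {a, b, c}) a (angle_area a b c)"
proof -
  obtain e where e: "0 < e"
    "\<And>r. r \<le> e \<Longrightarrow> convex hull {a, b, c} \<inter> ball a r = (+) a ` (sector (b - a) (c - a) \<inter> ball 0 r)"
    using triangle_near_vertex[OF assms] by blast
  then have "measure lebesgue (convex hull {a, b, c} \<inter> ball a r) = angle_area a b c * r\<^sup>2" if "0 < r" "r < e" for r
    using that measure_sector_scale[of r a "b - a" "c - a"] by (simp add: angle_area_def)
  then show ?thesis unfolding has_angle_def eventually_at_right_field using e(1) by blast
qed

text \<open>The triangles \<open>p y x\<close> and \<open>p x z\<close> lie in \<open>S\<close> by
  convexity, and together they fill a half-disc at \<open>p\<close>.\<close>

lemma angle_at_least_half:
  assumes "convex S" "p \<in> open_segment y z" "y \<in> S" "z \<in> S" "x \<in> S" "\<not> collinear {y, z, x :: plane}"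
  shows "angle_at_least S p half_disc_area"
proof -
  obtain t where t: "0 < t" "t < 1" "p = (1 - t) *\<^sub>R y + t *\<^sub>R z"
    using assms(2) by (auto simp: in_segment)
  have yz: "y - p = t *\<^sub>R (y - z)" "z - p = (1 - t) *\<^sub>R (- (y - z))" by (simp_all add: t(3) algebra_simps)
  define u w where "u = y - z" and "w = x - p"
  have uw: "cross2 u w \<noteq> 0"
  proof -
    have "cross2 (z - y) (x - y) = - cross2 u w"
      by (simp add: u_def w_def t(3) cross2_def algebra_simps)
    then show ?thesis using assms(6) by (simp add: collinear_iff_cross2)
  qed
  have wu: "cross2 w (- u) \<noteq> 0" using uw cross2_commute[of w u] by simp
  have nc1: "\<not> collinear {p, y, x}" and nc2: "\<not> collinear {p, x, z}"
    unfolding collinear_iff_cross2 yz w_def[symmetric] u_def[symmetric] using uw wu t by auto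
  have sec: "sector (y - p) (x - p) = sector u w" "sector (x - p) (z - p) = sector w (- u)"
    unfolding yz w_def[symmetric] u_def[symmetric]
    using sector_scaleR[of t 1 u w] sector_scaleR[of 1 "1 - t" w "- u"] t by simp_all
  have "p \<in> S"
    using assms(1-4) by (auto simp: convex_contains_open_segment)
  then have sub: "convex hull {p, y, x} \<subseteq> S" "convex hull {p, x, z} \<subseteq> S"
    using assms by (intro hull_minimal; simp)+
  obtain e1 where e1: "0 < e1"
    "\<And>r. r \<le> e1 \<Longrightarrow> convex hull {p, y, x} \<inter> ball p r = (+) p ` (sector u w \<inter> ball 0 r)"
    using triangle_near_vertex[OF nc1] sec by metis
  obtain e2 where e2: "0 < e2"
    "\<And>r. r \<le> e2 \<Longrightarrow> convex hull {p, x, z} \<inter> ball p r = (+) p ` (sector w (- u) \<inter> ball 0 r)"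
    using triangle_near_vertex[OF nc2] sec by metis
  have "half_disc_area * r\<^sup>2 \<le> measure lebesgue (S \<inter> ball p r)" if r: "0 < r" "r < min e1 e2" for r
  proof -
    have "(+) p ` ((sector u w \<union> sector w (- u)) \<inter> ball 0 r) =
      (convex hull {p, y, x} \<inter> ball p r) \<union> (convex hull {p, x, z} \<inter> ball p r)"
      using e1(2)[of r] e2(2)[of r] r by (simp add: Int_Un_distrib2 image_Un)
    then have *: "half_disc_area * r\<^sup>2 =
       measure lebesgue ((convex hull {p, y, x} \<inter> ball p r) \<union> (convex hull {p, x, z} \<inter> ball p r))"
      using measure_half_disc_scale[OF uw r(1), of p] by simp
    show ?thesis
      unfolding *
    proof (rule measure_mono_fmeasurable)
      show "(convex hull {p, y, x} \<inter> ball p r) \<union> (convex hull {p, x, z} \<inter> ball p r) \<subseteq> S \<inter> ball p r"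
        using sub by blast
      show "S \<inter> ball p r \<in> lmeasurable"
        using assms(1) by (intro measurable_convex convex_Int) auto
      have "(convex hull {p, y, x} \<inter> ball p r) \<union> (convex hull {p, x, z} \<inter> ball p r) \<in> lmeasurable"
        by (intro fmeasurable.Un measurable_convex convex_Int convex_convex_hull) auto
      then show "(convex hull {p, y, x} \<inter> ball p r) \<union> (convex hull {p, x, z} \<inter> ball p r) \<in> sets lebesgue"
        by (rule fmeasurableD)
    qed
  qed
  moreover have "0 < min e1 e2" using e1 e2 by simp
  ultimately show ?thesis unfolding angle_at_least_def eventually_at_right_field by blast
qed

text \<open>The triangle contains a small half-disc at \<open>p\<close> by convexity, and no more,
  since it lies on one side of the line through \<open>a\<close> and \<open>b\<close>.\<close>

lemma has_angle_edge:
  assumes nc: "\<not> collinear {a, b, c :: plane}" and p: "p = a + x *\<^sub>R (b - a)" "0 < x" "x < 1"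
  shows "has_angle (convex hull {a, b, c}) p half_disc_area"
proof -
  define u w where "u = b - a" and "w = c - a"
  have uw: "cross2 u w \<noteq> 0" using nc by (simp add: collinear_iff_cross2 u_def w_def)
  have "a \<noteq> b" using nc by auto
  then have seg: "p \<in> open_segment a b"
    using p unfolding in_segment by (auto intro!: exI[of _ x] simp: algebra_simps)
  have lower: "angle_at_least (convex hull {a, b, c}) p half_disc_area"
    by (rule angle_at_least_half[OF convex_convex_hull seg]) (use nc in \<open>auto intro: hull_inc\<close>)
  have upper: "measure lebesgue (convex hull {a, b, c} \<inter> ball p r) \<le> half_disc_area * r\<^sup>2" if "0 < r" for r
    unfolding measure_half_disc_scale[OF uw that, symmetric, of p]
  proof (rule measure_mono_fmeasurable)
    show "convex hull {a, b, c} \<inter> ball p r \<subseteq> (+) p ` ((sector u w \<union> sector w (- u)) \<inter> ball 0 r)"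
    proof
      fix z assume z: "z \<in> convex hull {a, b, c} \<inter> ball p r"
      then obtain s t where st: "z = a + s *\<^sub>R u + t *\<^sub>R w" "0 \<le> s" "0 \<le> t"
        using convex_hull_3_iff[of z] by (auto simp: u_def w_def)
      have "z - p = (s - x) *\<^sub>R u + t *\<^sub>R w" by (simp add: st(1) p(1) u_def[symmetric] algebra_simps)
      then have "cross2 u (z - p) = t * cross2 u w" by (simp add: cross2_add)
      then have "z - p \<in> sector u w \<union> sector w (- u)"
        unfolding sector_area_half(3)[OF uw] using st uw by simp
      moreover have "z - p \<in> ball 0 r" using z by (simp add: dist_norm norm_minus_commute)
      ultimately have "p + (z - p) \<in> (+) p ` ((sector u w \<union> sector w (- u)) \<inter> ball 0 r)" by blast
      then show "z \<in> (+) p ` ((sector u w \<union> sector w (- u)) \<inter> ball 0 r)" by simp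
    qed
    have "convex hull {a, b, c} \<inter> ball p r \<in> lmeasurable"
      by (intro measurable_convex convex_Int convex_convex_hull) auto
    then show "convex hull {a, b, c} \<inter> ball p r \<in> sets lebesgue" by (rule fmeasurableD)
    have "(sector u w \<inter> ball 0 r) \<union> (sector w (- u) \<inter> ball 0 r) \<in> lmeasurable"
      by (intro fmeasurable.Un sector_lmeasurable)
    then show "(+) p ` ((sector u w \<union> sector w (- u)) \<inter> ball 0 r) \<in> lmeasurable"
      by (intro measurable_translation) (simp add: Int_Un_distrib2)
  qed
  show ?thesis
    using lower unfolding has_angle_def angle_at_least_def
  proof -
    assume "\<forall>\<^sub>F r in at_right 0. half_disc_area * r\<^sup>2 \<le> measure lebesgue (convex hull {a, b, c} \<inter> ball p r)"
    then show "\<forall>\<^sub>F r in at_right 0. measure lebesgue (convex hull {a, b, c} \<inter> ball p r) = half_disc_area * r\<^sup>2"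
      using eventually_at_right_less[of 0] by eventually_elim (use upper in \<open>force intro: antisym\<close>)
  qed
qed

section \<open>Corner tiles\<close>

lemma cross2_eq_0_trans:
  assumes "e \<noteq> 0" "cross2 e u = 0" "cross2 e w = 0"
  shows "cross2 u w = 0"
proof (rule ccontr)
  assume n: "cross2 u w \<noteq> 0"
  have "e = (cross2 e w / cross2 u w) *\<^sub>R u + (cross2 u e / cross2 u w) *\<^sub>R w"
    by (rule cross2_coordinates[OF n])
  also have "\<dots> = 0" using assms cross2_commute[of u e] by simp
  finally show False using assms(1) by simp
qed

lemma cross2_unique:
  assumes "cross2 u w \<noteq> 0" "x *\<^sub>R u + y *\<^sub>R w = x' *\<^sub>R u + y' *\<^sub>R w"
  shows "x = x'" "y = y'"
proof -
  have "cross2 (x *\<^sub>R u + y *\<^sub>R w) w = cross2 (x' *\<^sub>R u + y' *\<^sub>R w) w"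
    "cross2 u (x *\<^sub>R u + y *\<^sub>R w) = cross2 u (x' *\<^sub>R u + y' *\<^sub>R w)"
    using assms(2) by simp_all
  then show "x = x'" "y = y'" using assms(1) by (simp_all add: cross2_add)
qed

text \<open>Pins a side of a neighbouring tile to the whole chord.\<close>

lemma segment_ends_of_dist:
  fixes P Q :: plane
  assumes "X = P + s *\<^sub>R (Q - P)" "0 \<le> s" "s \<le> 1" "Y = P + t *\<^sub>R (Q - P)" "0 \<le> t" "t \<le> 1"
    "dist P Q \<le> dist X Y" "P \<noteq> Q"
  shows "(X = P \<and> Y = Q) \<or> (X = Q \<and> Y = P)"
proof -
  have "X - Y = (s - t) *\<^sub>R (Q - P)" unfolding assms(1,4) by (simp add: algebra_simps)
  then have "dist X Y = \<bar>s - t\<bar> * dist P Q" by (simp add: dist_norm norm_minus_commute)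
  then have "1 \<le> \<bar>s - t\<bar>" using assms(7,8) by simp
  then have "(s = 0 \<and> t = 1) \<or> (s = 1 \<and> t = 0)" using assms by linarith
  then show ?thesis using assms(1,4) by auto
qed

text \<open>With sorted sides, \<open>A\<close> carries the smallest angle and \<open>C\<close> the
  largest; equal sides are allowed. Acuteness is stated at \<open>C\<close>.\<close>

locale sorted_acute_triangle =
  fixes A B C :: plane
  assumes noncollinear: "\<not> collinear {A, B, C}"
    and sides: "dist B C \<le> dist A C" "dist A C \<le> dist A B"
    and acute: "0 < (A - C) \<bullet> (B - C)"
begin

abbreviation "T \<equiv> convex hull {A, B, C}"
abbreviation "a \<equiv> dist B C"
abbreviation "b \<equiv> dist A C"
abbreviation "c \<equiv> dist A B"
abbreviation "\<alpha> \<equiv> angle_area A B C"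
abbreviation "\<beta> \<equiv> angle_area B A C"
abbreviation "\<gamma> \<equiv> angle_area C A B"

lemma angle_order: "\<alpha> \<le> \<beta>" "\<beta> \<le> \<gamma>" "a = b \<Longrightarrow> \<alpha> = \<beta>" "a < b \<Longrightarrow> \<alpha> < \<beta>" "b = c \<Longrightarrow> \<beta> = \<gamma>" "b < c \<Longrightarrow> \<beta> < \<gamma>"
proof -
  show 1: "a = b \<Longrightarrow> \<alpha> = \<beta>" using angle_area_eq[OF noncollinear] by simp
  show 2: "a < b \<Longrightarrow> \<alpha> < \<beta>" using angle_area_less[OF noncollinear] by simp
  have nc: "\<not> collinear {B, C, A}" using noncollinear by (simp add: insert_commute)
  show 3: "b = c \<Longrightarrow> \<beta> = \<gamma>"
    using angle_area_eq[OF nc] by (simp add: dist_commute angle_area_commute)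
  show 4: "b < c \<Longrightarrow> \<beta> < \<gamma>"
    using angle_area_less[OF nc] by (simp add: dist_commute angle_area_commute)
  show "\<alpha> \<le> \<beta>" "\<beta> \<le> \<gamma>" using 1 2 3 4 sides by force+
qed

lemma angle_pos: "0 < \<alpha>"
  unfolding angle_area_def using noncollinear by (intro sector_area_pos) (simp add: collinear_iff_cross2)

lemma angle_sum: "\<alpha> + \<beta> + \<gamma> = half_disc_area"
  using angle_area_sum[OF noncollinear] .

lemma angle_acute: "2 * \<gamma> < half_disc_area"
proof -
  have "\<not> collinear {C, A, B}" using noncollinear by (simp add: insert_commute)
  then show ?thesis
    unfolding angle_area_def using acute by (intro sector_area_acute) (auto simp: collinear_iff_cross2)
qed

lemma side_acute: "c\<^sup>2 < a\<^sup>2 + b\<^sup>2"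
proof -
  have "c\<^sup>2 = a\<^sup>2 + b\<^sup>2 - 2 * ((A - C) \<bullet> (B - C))"
    unfolding dist_norm power2_norm_eq_inner by (simp add: algebra_simps inner_commute)
  then show ?thesis using acute by simp
qed

text \<open>The vertices may correspond to those of \<open>T\<close> in any order.\<close>

definition copy :: "real \<Rightarrow> plane \<Rightarrow> plane \<Rightarrow> plane \<Rightarrow> bool" where
  "copy k x y z \<longleftrightarrow> (\<exists>h. similarity k h \<and>
    (x = h A \<and> y = h B \<and> z = h C \<or> x = h A \<and> y = h C \<and> z = h B \<or>
     x = h B \<and> y = h A \<and> z = h C \<or> x = h B \<and> y = h C \<and> z = h A \<or>
     x = h C \<and> y = h A \<and> z = h B \<or> x = h C \<and> y = h B \<and> z = h A))"

lemma copy_swap: "copy k x y z \<Longrightarrow> copy k x z y" "copy k x y z \<Longrightarrow> copy k y x z"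
  unfolding copy_def by blast+

text \<open>In every correspondence of the vertices, the angle at \<open>x\<close> and the side
  \<open>y z\<close> come from an opposite pair of \<open>T\<close>. As angles grow strictly with
  the opposite sides, smallest angle and smallest side determine each other, even if several
  vertices are small.\<close>

lemma copy_facts:
  assumes "copy k x y z"
  shows "0 < k" "\<not> collinear {x, y, z}" "k * a \<le> dist y z" "dist y z \<le> k * c"
    "\<alpha> \<le> angle_area x y z" "angle_area x y z = \<alpha> \<longleftrightarrow> dist y z = k * a"
    "dist y z = k * a \<Longrightarrow> angle_area y x z = \<beta> \<and> angle_area z x y = \<gamma> \<or>
      angle_area y x z = \<gamma> \<and> angle_area z x y = \<beta>"
proof -
  obtain h where h: "similarity k h" and xyz:
    "x = h A \<and> y = h B \<and> z = h C \<or> x = h A \<and> y = h C \<and> z = h B \<or>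
     x = h B \<and> y = h A \<and> z = h C \<or> x = h B \<and> y = h C \<and> z = h A \<or>
     x = h C \<and> y = h A \<and> z = h B \<or> x = h C \<and> y = h B \<and> z = h A"
    using assms unfolding copy_def by blast
  show k: "0 < k" using h by (simp add: similarity_def)
  have d: "dist (h u) (h v) = k * dist u v" for u v using h by (simp add: similarity_def)
  note ang = angle_area_similarity[OF h]
  have comm: "angle_area A C B = \<alpha>" "angle_area B C A = \<beta>" "angle_area C B A = \<gamma>"
    "dist C B = a" "dist C A = b" "dist B A = c"
    by (simp_all add: angle_area_commute dist_commute)
  show "\<not> collinear {x, y, z}"
  proof -
    have "{x, y, z} = {h A, h B, h C}" using xyz by (elim disjE conjE) (simp_all add: insert_commute)
    then show ?thesis using collinear_similarity[OF h noncollinear] by simp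
  qed
  have opp: "(dist y z = k * a \<and> angle_area x y z = \<alpha>) \<or> (dist y z = k * b \<and> angle_area x y z = \<beta>)
     \<or> (dist y z = k * c \<and> angle_area x y z = \<gamma>)"
    using xyz by (auto simp: d ang comm)
  have le: "k * a \<le> k * b" "k * b \<le> k * c" using sides k by (auto intro: mult_left_mono)
  show "k * a \<le> dist y z" "dist y z \<le> k * c" "\<alpha> \<le> angle_area x y z"
    using opp le angle_order(1,2) by auto
  have e: "k * b = k * a \<longleftrightarrow> a = b" "k * c = k * a \<longleftrightarrow> a = c" using k by auto
  show "angle_area x y z = \<alpha> \<longleftrightarrow> dist y z = k * a"
    using opp
  proof (elim disjE conjE)
    assume B: "dist y z = k * b" "angle_area x y z = \<beta>"
    show ?thesis
    proof (cases "a = b")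
      case True
      then show ?thesis using B angle_order(3) by simp
    next
      case False
      then have "\<beta> \<noteq> \<alpha>" using angle_order(4) sides(1) by simp
      then show ?thesis using B e(1) False by simp
    qed
  next
    assume C: "dist y z = k * c" "angle_area x y z = \<gamma>"
    show ?thesis
    proof (cases "a = c")
      case True
      then have "a = b" "b = c" using sides by simp_all
      then have "\<gamma> = \<alpha>" using angle_order(3,5) by simp
      then show ?thesis using C True by simp
    next
      case False
      then have "\<gamma> \<noteq> \<alpha>" using angle_order(1,2,4,6) sides by fastforce
      then show ?thesis using C e(2) False by simp
    qed
  qed auto
  show "angle_area y x z = \<beta> \<and> angle_area z x y = \<gamma> \<or> angle_area y x z = \<gamma> \<and> angle_area z x y = \<beta>"
    if "dist y z = k * a"
  proof -
    have "angle_area x y z = \<alpha>"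
      using \<open>angle_area x y z = \<alpha> \<longleftrightarrow> dist y z = k * a\<close> that by simp
    then show ?thesis using xyz by (auto simp: ang comm)
  qed
qed

section \<open>Tiles and their vertices\<close>

definition tile :: "real \<Rightarrow> plane set \<Rightarrow> bool" where
  "tile k q \<longleftrightarrow> (\<exists>x y z. copy k x y z \<and> q = convex hull {x, y, z})"

lemma tileE:
  assumes "tile k q"
  obtains x y z where "copy k x y z" "q = convex hull {x, y, z}"
  using assms unfolding tile_def by blast

lemma tile_convex: "tile k q \<Longrightarrow> convex q" and tile_compact: "tile k q \<Longrightarrow> compact q"
  unfolding tile_def by (auto intro: finite_imp_compact_convex_hull)

lemma tile_closed: "tile k q \<Longrightarrow> closed q"
  by (simp add: tile_compact compact_imp_closed)

lemma tile_interior: 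
  assumes "tile k q"
  shows "interior q \<noteq> {}"
proof -
  obtain x y z where "copy k x y z" "q = convex hull {x, y, z}" using assms by (rule tileE)
  \<comment> \<open>The centroid.\<close>
  then have "x + (1/3) *\<^sub>R (y - x) + (1/3) *\<^sub>R (z - x) \<in> interior q"
    using interior_triangle_iff[OF copy_facts(2)[of k x y z], of "x + (1/3) *\<^sub>R (y - x) + (1/3) *\<^sub>R (z - x)"]
    by (auto intro!: exI[of _ "1/3"])
  then show ?thesis by blast
qed

lemma tile_extreme:
  assumes "tile k q" "p extreme_point_of q"
  obtains y z where "copy k p y z" "q = convex hull {p, y, z}"
proof -
  obtain x y z where q: "copy k x y z" "q = convex hull {x, y, z}" using assms by (auto elim: tileE)
  then have "p \<in> {x, y, z}" using assms(2) extreme_point_of_convex_hull by blast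
  then consider "p = x" | "p = y" | "p = z" by blast
  then show thesis
  proof cases
    case 1 then show ?thesis using q that by blast
  next
    case 2
    have "q = convex hull {y, x, z}" using q(2) by (simp add: insert_commute)
    then show ?thesis using 2 that copy_swap(2)[OF q(1)] by blast
  next
    case 3
    have "q = convex hull {z, x, y}" using q(2) by (simp add: insert_commute)
    then show ?thesis using 3 that copy_swap(2)[OF copy_swap(1)[OF q(1)]] by blast
  qed
qed

text \<open>Such a point is inside a segment contained in the tile, and the tile has a further point
  off the line of that segment.\<close>

lemma tile_not_extreme:
  assumes "tile k q" "p \<in> q" "\<not> p extreme_point_of q"
  shows "angle_at_least q p half_disc_area"
proof -
  obtain y z where yz: "y \<in> q" "z \<in> q" "p \<in> open_segment y z"
    using assms(2,3) unfolding extreme_point_of_def by blast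
  obtain u v w where q: "copy k u v w" "q = convex hull {u, v, w}" using assms(1) by (rule tileE)
  have "y \<noteq> z" using yz(3) by auto
  have "\<exists>x\<in>q. \<not> collinear {y, z, x}"
  proof (rule ccontr)
    assume "\<not> ?thesis"
    then have *: "cross2 (z - y) (x - y) = 0" if "x \<in> {u, v, w}" for x
      using that q(2) hull_inc[of x "{u, v, w}"] by (auto simp: collinear_iff_cross2)
    have "cross2 (z - y) (v - u) = 0" "cross2 (z - y) (w - u) = 0"
      using *[of u] *[of v] *[of w] by (simp_all add: cross2_add)
    then have "cross2 (v - u) (w - u) = 0"
      using cross2_eq_0_trans \<open>y \<noteq> z\<close> by (metis eq_iff_diff_eq_0)
    then show False using copy_facts(2)[OF q(1)] by (simp add: collinear_iff_cross2)
  qed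
  then show ?thesis
    using angle_at_least_half[OF tile_convex[OF assms(1)] yz(3,1,2)] by blast
qed

text \<open>The common scale \<open>k\<close> encodes the congruence of the tiles. The tiled set
  \<open>t\<close> is arbitrary, so that the definition covers the whole triangle and single tiles
  of the first level.\<close>

definition tiling :: "real \<Rightarrow> plane set set \<Rightarrow> plane set \<Rightarrow> bool" where
  "tiling k F t \<longleftrightarrow> finite F \<and> (\<forall>q\<in>F. tile k q) \<and> \<Union>F = t \<and>
    (\<forall>q\<in>F. \<forall>q'\<in>F. q \<noteq> q' \<longrightarrow> interior q \<inter> interior q' = {})"

lemma tilingD:
  assumes "tiling k F t"
  shows "finite F" "\<Union>F = t" "\<And>q. q \<in> F \<Longrightarrow> tile k q"
    "\<And>q q'. q \<in> F \<Longrightarrow> q' \<in> F \<Longrightarrow> q \<noteq> q' \<Longrightarrow> interior q \<inter> interior q' = {}"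
  using assms unfolding tiling_def by auto

text \<open>The angle at \<open>v\<close> has room for one tile only, so near \<open>v\<close> this
  tile coincides with \<open>t\<close>. Hence the directions of both sides of \<open>t\<close> are
  nonnegative combinations of \<open>P - v\<close> and \<open>Q - v\<close>, which are themselves
  nonnegative combinations of those directions; this forces \<open>P\<close> and \<open>Q\<close>
  onto the two sides.\<close>

lemma corner_tile:
  assumes F: "tiling k F t" and t: "copy l v X Y" "t = convex hull {v, X, Y}" "angle_area v X Y = \<alpha>"
  obtains s P Q x y where "s \<in> F" "s = convex hull {v, P, Q}" "copy k v P Q" "dist P Q = k * a"
    "P = v + x *\<^sub>R (X - v)" "Q = v + y *\<^sub>R (Y - v)" "0 < x" "0 < y" "{q \<in> F. v \<in> q} = {s}"
proof -
  note F' = tilingD[OF F]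
  have nc: "\<not> collinear {v, X, Y}" using copy_facts(2)[OF t(1)] .
  have vt: "v extreme_point_of t" unfolding t(2) by (rule extreme_point_of_triangle[OF nc])
  have "\<exists>g. has_angle q v g \<and> (v \<in> q \<longrightarrow> \<alpha> \<le> g \<and> (\<exists>P Q. copy k v P Q \<and> q = convex hull {v, P, Q} \<and> g = angle_area v P Q))
      \<and> (v \<notin> q \<longrightarrow> g = 0)" if q: "q \<in> F" for q
  proof (cases "v \<in> q")
    case True
    have "q \<subseteq> t" using q F'(2) by blast
    then have "v extreme_point_of q" using vt True unfolding extreme_point_of_def by blast
    then obtain P Q where "copy k v P Q" "q = convex hull {v, P, Q}"
      using tile_extreme F'(3)[OF q] by metis
    then show ?thesis using True has_angle_vertex copy_facts(2,5) by blast
  next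
    case False
    then show ?thesis using has_angle_outside tile_closed[OF F'(3)[OF q]] by blast
  qed
  then obtain f where f: "\<And>q. q \<in> F \<Longrightarrow> has_angle q v (f q)"
    "\<And>q. q \<in> F \<Longrightarrow> v \<in> q \<Longrightarrow> \<alpha> \<le> f q \<and> (\<exists>P Q. copy k v P Q \<and> q = convex hull {v, P, Q} \<and> f q = angle_area v P Q)"
    "\<And>q. q \<in> F \<Longrightarrow> v \<notin> q \<Longrightarrow> f q = 0" by metis
  have "has_angle (\<Union>F) v \<alpha>" using has_angle_vertex[OF nc] t F'(2) by simp
  then have sum: "sum f F = \<alpha>"
    using has_angle_sum(1)[OF F'(1) _ tile_convex[OF F'(3)] F'(4)] f(1) by blast
  have f0: "0 \<le> f q" if "q \<in> F" for q using f(2,3)[OF that] angle_pos by force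
  have "v \<in> \<Union>F" using vt F'(2) by (simp add: extreme_point_of_def)
  then obtain s where s: "s \<in> F" "v \<in> s" by blast
  \<comment> \<open>each tile at \<open>v\<close> takes at least the smallest angle, which is all there is\<close>
  have only: "{q \<in> F. v \<in> q} = {s}"
  proof (rule ccontr)
    assume "\<not> ?thesis"
    then obtain q where q: "q \<in> F" "v \<in> q" "q \<noteq> s" using s by blast
    have "sum f {s, q} \<le> sum f F" using s q f0 F'(1) by (intro sum_mono2) auto
    then have "f s + f q \<le> \<alpha>" using q sum by simp
    then show False using f(2)[OF s] f(2)[OF q(1,2)] angle_pos by linarith
  qed
  have "sum f F = sum f {s}"
  proof (rule sum.mono_neutral_right)
    show "\<forall>q\<in>F - {s}. f q = 0" using only f(3) by blast
  qed (use s F'(1) in auto)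
  then have fs: "f s = \<alpha>" using sum by simp
  then obtain P Q where PQ: "copy k v P Q" "s = convex hull {v, P, Q}" "angle_area v P Q = \<alpha>"
    using f(2)[OF s] by metis
  then have dPQ: "dist P Q = k * a" using copy_facts(6) by blast
  define u w where "u = X - v" and "w = Y - v"
  have uw: "cross2 u w \<noteq> 0" using nc by (simp add: collinear_iff_cross2 u_def w_def)
  have ncs: "\<not> collinear {v, P, Q}" using copy_facts(2)[OF PQ(1)] .
  have st: "s \<subseteq> t" using s F'(2) by blast
  have PQt: "P \<in> t" "Q \<in> t" using st PQ(2) by (auto intro: hull_inc)
  obtain p q where P: "P = v + p *\<^sub>R u + q *\<^sub>R w" "0 \<le> p" "0 \<le> q"
    using PQt(1) convex_hull_3_iff[of P] t(2) by (auto simp: u_def w_def)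
  obtain p' q' where Q: "Q = v + p' *\<^sub>R u + q' *\<^sub>R w" "0 \<le> p'" "0 \<le> q'"
    using PQt(2) convex_hull_3_iff[of Q] t(2) by (auto simp: u_def w_def)
  define R where "R = \<Union>(F - {s})"
  have "closed R" unfolding R_def using F'(1,3) by (intro closed_Union) (auto intro: tile_closed)
  moreover have "v \<notin> R" using only s by (auto simp: R_def)
  ultimately obtain e where e: "0 < e" "ball v e \<subseteq> - R" using openE[of "- R" v] by auto
  \<comment> \<open>The other tiles stay away from \<open>v\<close>, so a short initial piece of any
    segment of \<open>t\<close> from \<open>v\<close> lies in \<open>s\<close>.\<close>
  have near: "\<exists>\<epsilon>>0. v + \<epsilon> *\<^sub>R d \<in> s" if d: "v + d \<in> t" for d
  proof -
    define \<epsilon> where "\<epsilon> = min 1 (e / (2 * (1 + norm d)))"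
    have n: "0 < 1 + norm d" by (simp add: add_pos_nonneg)
    have \<epsilon>: "0 < \<epsilon>" "\<epsilon> \<le> 1" using e n by (auto simp: \<epsilon>_def)
    have "norm (\<epsilon> *\<^sub>R d) < e"
    proof -
      have "\<epsilon> \<le> e / (2 * (1 + norm d))" by (simp add: \<epsilon>_def)
      then have "\<epsilon> * norm d \<le> (e / (2 * (1 + norm d))) * (1 + norm d)"
        using \<epsilon> by (intro mult_mono) simp_all
      then have "norm (\<epsilon> *\<^sub>R d) \<le> (e / (2 * (1 + norm d))) * (1 + norm d)"
        using \<epsilon> by simp
      also have "\<dots> = e / 2" using n by (simp add: field_simps)
      also have "\<dots> < e" using e by simp
      finally show ?thesis .
    qed
    then have "v + \<epsilon> *\<^sub>R d \<in> ball v e" by (simp add: dist_norm)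
    then have "v + \<epsilon> *\<^sub>R d \<notin> R" using e(2) by blast
    moreover have "v + \<epsilon> *\<^sub>R d \<in> t"
    proof -
      have "(1 - \<epsilon>) *\<^sub>R v + \<epsilon> *\<^sub>R (v + d) \<in> t"
        using \<epsilon> d vt t(2) by (intro convexD) (auto simp: extreme_point_of_def)
      then show ?thesis by (simp add: algebra_simps)
    qed
    ultimately show ?thesis using F'(2) s \<epsilon> by (auto simp: R_def)
  qed
  have X: "v + u \<in> t" "v + w \<in> t" using t(2) by (auto simp: u_def w_def intro: hull_inc)
  obtain \<epsilon>1 x1 y1 where 1: "0 < \<epsilon>1" "v + \<epsilon>1 *\<^sub>R u = v + x1 *\<^sub>R (P - v) + y1 *\<^sub>R (Q - v)" "0 \<le> x1" "0 \<le> y1"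
    using near[OF X(1)] PQ(2) convex_hull_3_iff by blast
  obtain \<epsilon>2 x2 y2 where 2: "0 < \<epsilon>2" "v + \<epsilon>2 *\<^sub>R w = v + x2 *\<^sub>R (P - v) + y2 *\<^sub>R (Q - v)" "0 \<le> x2" "0 \<le> y2"
    using near[OF X(2)] PQ(2) convex_hull_3_iff by blast
  have "\<epsilon>1 *\<^sub>R u + 0 *\<^sub>R w = (x1 * p + y1 * p') *\<^sub>R u + (x1 * q + y1 * q') *\<^sub>R w"
    using 1(2) unfolding P(1) Q(1) by (simp add: algebra_simps)
  from cross2_unique[OF uw this] have eq1: "x1 * p + y1 * p' = \<epsilon>1" "x1 * q + y1 * q' = 0" by simp_all
  have "0 *\<^sub>R u + \<epsilon>2 *\<^sub>R w = (x2 * p + y2 * p') *\<^sub>R u + (x2 * q + y2 * q') *\<^sub>R w"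
    using 2(2) unfolding P(1) Q(1) by (simp add: algebra_simps)
  from cross2_unique[OF uw this] have eq2: "x2 * p + y2 * p' = 0" "x2 * q + y2 * q' = \<epsilon>2" by simp_all
  \<comment> \<open>A vanishing sum of nonnegative products has vanishing terms.\<close>
  have z1: "x1 * q = 0" "y1 * q' = 0"
    using eq1(2) 1(3,4) P(3) Q(3) add_nonneg_eq_0_iff[of "x1 * q" "y1 * q'"] by auto
  have z2: "x2 * p = 0" "y2 * p' = 0"
    using eq2(1) 2(3,4) P(2) Q(2) add_nonneg_eq_0_iff[of "x2 * p" "y2 * p'"] by auto
  show thesis
  \<comment> \<open>\<open>q\<close> is the coordinate of \<open>P\<close> along the side towards
    \<open>Y\<close>. If it is nonzero, then \<open>P\<close> lies on that side and the names
    \<open>P\<close> and \<open>Q\<close> are exchanged.\<close>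
  proof (cases "q = 0")
    case True
    then have "y2 * q' = \<epsilon>2" using eq2 by simp
    then have y2: "y2 \<noteq> 0" "0 < q'" using 2 Q(3) by (auto simp: less_le)
    then have p': "p' = 0" using z2 by simp
    then have "x1 * p = \<epsilon>1" using eq1 by simp
    then have "0 < p" using 1 P(2) by (auto simp: less_le)
    then show thesis
      using that[of s P Q p q'] s PQ dPQ P(1) Q(1) True p' y2 only by (simp add: u_def w_def)
  next
    case False
    then have x1: "x1 = 0" using z1 by simp
    then have "y1 * p' = \<epsilon>1" using eq1 by simp
    then have "y1 \<noteq> 0" and p': "0 < p'" using 1 Q(2) by (auto simp: less_le)
    then have q': "q' = 0" using z1 by simp
    then have "x2 * q = \<epsilon>2" using eq2 by simp
    then have "x2 \<noteq> 0" "0 < q" using 2 P(3) by (auto simp: less_le)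
    then have "p = 0" using z2 by simp
    have "s = convex hull {v, Q, P}" using PQ(2) by (simp add: insert_commute)
    then show thesis
      using that[of s Q P p' q] s copy_swap(1)[OF PQ(1)] dPQ P(1) Q(1) \<open>p = 0\<close> q' p' \<open>0 < q\<close> only
      by (simp add: u_def w_def dist_commute)
  qed
qed

text \<open>Connectedness yields a common boundary point \<open>z\<close> of the tiles that is
  interior to their union. It lies inside the chord, and beyond the chord a half-disc at
  \<open>z\<close> belongs to \<open>p\<close>. So \<open>p\<close> has a side on the line
  \<open>PQ\<close>; this side lies within the chord and is not shorter than it, hence equals
  it.\<close>

lemma corner_neighbour:
  assumes t: "\<not> collinear {v, X, Y}" "t = convex hull {v, X, Y}"
    and s: "copy k v P Q" "s = convex hull {v, P, Q}" "dist P Q = k * a"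
    and PQ: "P = v + x *\<^sub>R (X - v)" "Q = v + y *\<^sub>R (Y - v)" "0 < x" "0 < y"
    and p: "tile k p" "p \<subseteq> t" "s \<subseteq> t" "interior s \<inter> interior p = {}"
    and conn: "connected (interior (s \<union> p))"
  obtains O' where "p = convex hull {O', P, Q}" "copy k O' P Q" "cross2 (Q - P) (O' - P) / cross2 (Q - P) (v - P) < 0"
    "O' \<notin> s"
proof -
  define e where "e = Q - P"
  \<comment> \<open>Signed distance from the line \<open>PQ\<close>, scaled to be 1 at
    \<open>v\<close>; it is nonnegative on \<open>s\<close>.\<close>
  define g where "g z = cross2 e (z - P) / cross2 e (v - P)" for z
  have ncs: "\<not> collinear {v, P, Q}" using copy_facts(2)[OF s(1)] .
  have "cross2 e (v - P) = cross2 (P - v) (Q - v)"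
    by (simp add: e_def cross2_def algebra_simps)
  then have ev: "cross2 e (v - P) \<noteq> 0" using ncs by (simp add: collinear_iff_cross2)
  then have e0: "e \<noteq> 0" by auto
  have gv: "g v = 1" "g P = 0" "g Q = 0" using ev by (simp_all add: g_def e_def)
  have g_aff: "g (z + r *\<^sub>R d) = g z + r * (cross2 e d / cross2 e (v - P))" for z r d
  proof -
    have "cross2 e (z + r *\<^sub>R d - P) = cross2 e (z - P) + r * cross2 e d" by (simp add: cross2_add)
    then show ?thesis by (simp add: g_def add_divide_distrib)
  qed
  have gP: "g (v + i *\<^sub>R (P - v) + j *\<^sub>R (Q - v)) = 1 - i - j" for i j
  proof -
    have "cross2 e (P - v) = - cross2 e (v - P)" "cross2 e (Q - v) = - cross2 e (v - P)"
      by (simp_all add: e_def cross2_def algebra_simps)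
    then show ?thesis using ev gv by (simp add: g_aff)
  qed
  have gs: "0 \<le> g z" if "z \<in> s" for z
    using that convex_hull_3_iff[of z] s(2) by (auto simp: gP)
  have ints: "interior s \<noteq> {}" using s by (intro tile_interior[of k]) (auto simp: tile_def)
  have intp: "interior p \<noteq> {}" using p(1) by (rule tile_interior)
  \<comment> \<open>Otherwise the disjoint nonempty interiors of \<open>s\<close> and
    \<open>p\<close> would separate the interior of the union.\<close>
  have "\<exists>z \<in> interior (s \<union> p). z \<notin> interior s \<and> z \<notin> interior p"
  proof (rule ccontr)
    assume "\<not> ?thesis"
    then have "interior (s \<union> p) \<subseteq> interior s \<union> interior p" by blast
    moreover have "interior s \<subseteq> interior (s \<union> p)" "interior p \<subseteq> interior (s \<union> p)"
      by (intro interior_mono; blast)+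
    ultimately show False
      using connectedD[OF conn open_interior[of s] open_interior[of p]] p(4) ints intp by blast
  qed
  then obtain z where z: "z \<in> interior (s \<union> p)" "z \<notin> interior s" "z \<notin> interior p" by blast
  obtain r where r: "0 < r" "ball z r \<subseteq> s \<union> p" using z(1) by (auto simp: mem_interior)
  have closed: "closed s" "closed p" using p(1) s(2) by (auto intro: tile_closed simp: compact_imp_closed finite_imp_compact_convex_hull)
  \<comment> \<open>Off the closed set \<open>s\<close>, the interior of the union is an open part
    of \<open>p\<close>, so \<open>z\<close> would be interior to \<open>p\<close>.\<close>
  have zs: "z \<in> s"
  proof (rule ccontr)
    assume "z \<notin> s"
    then have "z \<in> interior (s \<union> p) \<inter> - s" "open (interior (s \<union> p) \<inter> - s)"
      using z closed by auto
    moreover have "interior (s \<union> p) \<inter> - s \<subseteq> p" using interior_subset by blast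
    ultimately show False using z(3) interior_maximal by blast
  qed
  have zp: "z \<in> p"
  proof (rule ccontr)
    assume "z \<notin> p"
    then have "z \<in> interior (s \<union> p) \<inter> - p" "open (interior (s \<union> p) \<inter> - p)"
      using z closed by auto
    moreover have "interior (s \<union> p) \<inter> - p \<subseteq> s" using interior_subset by blast
    ultimately show False using z(2) interior_maximal by blast
  qed
  \<comment> \<open>This keeps \<open>z\<close> off the two sides of \<open>s\<close> at
    \<open>v\<close>, which run along sides of \<open>t\<close>; only the side \<open>PQ\<close>
    remains.\<close>
  have zt: "z \<in> interior t" using z(1) p(2,3) interior_mono[of "s \<union> p" t] by blast
  obtain i j where ij: "z = v + i *\<^sub>R (P - v) + j *\<^sub>R (Q - v)" "0 \<le> i" "0 \<le> j" "i + j \<le> 1"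
    using zs convex_hull_3_iff[of z] s(2) by auto
  obtain m n where mn: "z = v + m *\<^sub>R (X - v) + n *\<^sub>R (Y - v)" "0 < m" "0 < n"
    using zt interior_triangle_iff[OF t(1), of z] t(2) by auto
  have XY: "cross2 (X - v) (Y - v) \<noteq> 0" using t(1) by (simp add: collinear_iff_cross2)
  have "(i * x) *\<^sub>R (X - v) + (j * y) *\<^sub>R (Y - v) = m *\<^sub>R (X - v) + n *\<^sub>R (Y - v)"
  proof -
    have "i *\<^sub>R (P - v) + j *\<^sub>R (Q - v) = m *\<^sub>R (X - v) + n *\<^sub>R (Y - v)"
    proof (rule add_left_imp_eq)
      show "v + (i *\<^sub>R (P - v) + j *\<^sub>R (Q - v)) = v + (m *\<^sub>R (X - v) + n *\<^sub>R (Y - v))"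
        unfolding add.assoc[symmetric] ij(1)[symmetric] mn(1)[symmetric] ..
    qed
    then show ?thesis by (simp add: PQ(1,2))
  qed
  from cross2_unique[OF XY this] have "i * x = m" "j * y = n" .
  then have ij0: "0 < i" "0 < j" using mn PQ ij by (auto simp: less_le)
  have "\<not> i + j < 1" using z(2) interior_triangle_iff[OF ncs, of z] s(2) ij ij0 by blast
  then have ij1: "i + j = 1" using ij by simp
  then have gz: "g z = 0" by (simp add: ij(1) gP)
  have far: "z' \<in> p" if "dist z z' < r" "g z' < 0" for z'
    using that r(2) gs[of z'] by (force simp: subset_iff)
  \<comment> \<open>Points of the line near \<open>z\<close> are limits of points beyond it, which
    belong to the closed set \<open>p\<close>.\<close>
  have line: "z + \<delta> *\<^sub>R e \<in> p" if \<delta>: "\<bar>\<delta>\<bar> * norm e < r" for \<delta>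
  proof (rule Lim_in_closed_set[OF closed(2)])
    show "((\<lambda>\<epsilon>. z + \<delta> *\<^sub>R e - \<epsilon> *\<^sub>R (v - P)) \<longlongrightarrow> z + \<delta> *\<^sub>R e) (at_right 0)"
      by (rule tendsto_eq_intros refl | simp)+
    then have "((\<lambda>\<epsilon>. dist z (z + \<delta> *\<^sub>R e - \<epsilon> *\<^sub>R (v - P))) \<longlongrightarrow> dist z (z + \<delta> *\<^sub>R e)) (at_right 0)"
      by (intro tendsto_dist tendsto_const)
    moreover have "dist z (z + \<delta> *\<^sub>R e) < r" using \<delta> by (simp add: dist_norm)
    ultimately have "\<forall>\<^sub>F \<epsilon> in at_right 0. dist z (z + \<delta> *\<^sub>R e - \<epsilon> *\<^sub>R (v - P)) < r"
      by (rule order_tendstoD(2))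
    then show "\<forall>\<^sub>F \<epsilon> in at_right 0. z + \<delta> *\<^sub>R e - \<epsilon> *\<^sub>R (v - P) \<in> p"
      using eventually_at_right_less[of 0]
    proof eventually_elim
      case (elim \<epsilon>)
      have "g (z + \<delta> *\<^sub>R e + (- \<epsilon>) *\<^sub>R (v - P)) = - \<epsilon>"
        using ev gz by (simp only: g_aff) simp
      then show ?case using elim far by simp
    qed
  qed simp
  obtain \<delta> where \<delta>: "0 < \<delta>" "\<delta> * norm e < r" "\<delta> * norm (v - P) < r"
  proof
    define D where "D = r / (2 * (norm e + norm (v - P) + 1))"
    have D: "0 < norm e + norm (v - P) + 1" by (simp add: add_nonneg_pos)
    show "0 < D" using D r by (simp add: D_def)
    have "D * (norm e + norm (v - P) + 1) = r / 2" using D by (simp add: D_def field_simps)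
    then have "D * norm e + D * norm (v - P) + D = r / 2" by (simp add: algebra_simps)
    moreover have "0 \<le> D * norm e" "0 \<le> D * norm (v - P)" using \<open>0 < D\<close> by auto
    ultimately show "D * norm e < r" "D * norm (v - P) < r" using \<open>0 < D\<close> r by linarith+
  qed
  have in_p: "z + \<delta> *\<^sub>R e \<in> p" "z + (- \<delta>) *\<^sub>R e \<in> p" using line[of \<delta>] line[of "- \<delta>"] \<delta> by auto
  have far_p: "z + (- \<delta>) *\<^sub>R (v - P) \<in> p"
  proof (rule far)
    show "g (z + (- \<delta>) *\<^sub>R (v - P)) < 0" using ev gz \<delta> by (simp only: g_aff) simp
  qed (use \<delta> in \<open>simp add: dist_norm\<close>)
  \<comment> \<open>\<open>p\<close> contains a half-disc at \<open>z\<close>, so its supporting line at \<open>z\<close> is the line \<open>PQ\<close>\<close>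
  have "z \<notin> rel_interior p" using z(3) intp by (simp add: rel_interior_nonempty_interior)
  then obtain n where n: "n \<noteq> 0" "\<And>y. y \<in> p \<Longrightarrow> n \<bullet> z \<le> n \<bullet> y"
    using supporting_hyperplane_rel_boundary[OF tile_convex[OF p(1)] zp] by metis
  have "0 \<le> \<delta> * (n \<bullet> e)" "0 \<le> (- \<delta>) * (n \<bullet> e)" "0 \<le> (- \<delta>) * (n \<bullet> (v - P))"
    using n(2)[OF in_p(1)] n(2)[OF in_p(2)] n(2)[OF far_p]
    by (simp_all only: inner_add_right inner_scaleR_right le_add_same_cancel1)
  then have ne: "n \<bullet> e = 0" "n \<bullet> (v - P) \<le> 0"
    using \<delta>(1) by (auto simp: zero_le_mult_iff mult_le_0_iff)
  have coord: "w = (cross2 w (v - P) / cross2 e (v - P)) *\<^sub>R e + (cross2 e w / cross2 e (v - P)) *\<^sub>R (v - P)" for w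
    by (rule cross2_coordinates[OF ev])
  have "n \<bullet> (v - P) \<noteq> 0"
  proof
    assume "n \<bullet> (v - P) = 0"
    then have "n \<bullet> n = 0"
      by (subst (2) coord) (simp add: inner_add_right ne)
    then show False using n(1) by simp
  qed
  then have nv: "n \<bullet> (v - P) < 0" using ne by simp
  have gp: "g w \<le> 0" if "w \<in> p" for w
  proof -
    have "cross2 e (w - z) / cross2 e (v - P) = g w"
      using g_aff[of z 1 "w - z"] gz by simp
    then have "n \<bullet> (w - z) = g w * (n \<bullet> (v - P))"
      by (subst coord) (simp add: inner_add_right ne)
    moreover have "0 \<le> n \<bullet> (w - z)" using n(2)[OF that] by (simp add: inner_diff_right)
    ultimately show ?thesis using nv by (simp add: zero_le_mult_iff)
  qed
  have conv: "g ((1 - i - j) *\<^sub>R x + i *\<^sub>R y + j *\<^sub>R z) = (1 - i - j) * g x + i * g y + j * g z" for i j x y z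
  proof -
    have "cross2 e ((1 - i - j) *\<^sub>R x + i *\<^sub>R y + j *\<^sub>R z - P) =
      (1 - i - j) * cross2 e (x - P) + i * cross2 e (y - P) + j * cross2 e (z - P)"
      by (simp add: cross2_add algebra_simps)
    then show ?thesis by (simp add: g_def add_divide_distrib)
  qed
  \<comment> \<open>If two vertices were strictly beyond the line, \<open>p\<close> would meet the
    line in the third vertex at most, but it contains both \<open>z\<close> and
    \<open>z + \<delta> *\<^sub>R e\<close>.\<close>
  have two: "g x = 0 \<or> g y = 0" if xyz: "p = convex hull {x, y, z}" for x y z
  proof (rule ccontr)
    assume "\<not> ?thesis"
    moreover have "x \<in> p" "y \<in> p" "z \<in> p" using xyz by (auto intro: hull_inc)
    ultimately have neg: "g x < 0" "g y < 0" "g z \<le> 0" using gp by force+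
    have "w = z" if w: "w \<in> p" "g w = 0" for w
    proof -
      obtain a b c where abc: "0 \<le> a" "0 \<le> b" "0 \<le> c" "a + b + c = 1" "w = a *\<^sub>R x + b *\<^sub>R y + c *\<^sub>R z"
        using w(1) unfolding xyz convex_hull_3 by blast
      have "a = 1 - b - c" using abc by simp
      then have "a * g x + b * g y + c * g z = g w" using conv[of b c x y z] abc(5) by simp
      then have "a * g x + b * g y + c * g z = 0" using w by simp
      moreover have "a * g x \<le> 0" "b * g y \<le> 0" "c * g z \<le> 0"
        using neg abc by (auto simp: mult_le_0_iff)
      ultimately have "a * g x = 0" "b * g y = 0" by linarith+
      then have "a = 0" "b = 0" using neg by auto
      then show ?thesis using abc by simp
    qed
    moreover have "g (z' + \<delta> *\<^sub>R e) = g z'" for z' by (simp add: g_aff)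
    ultimately show False using in_p(1) zp gz e0 \<delta>(1) 
      by (metis add_cancel_right_right less_irrefl scaleR_eq_0_iff)
  qed
  obtain x1 y1 z1 where q: "copy k x1 y1 z1" "p = convex hull {x1, y1, z1}" using p(1) by (rule tileE)
  have perm: "p = convex hull {y1, z1, x1}" "p = convex hull {x1, z1, y1}" "p = convex hull {y1, x1, z1}"
    "p = convex hull {z1, x1, y1}"
    using q(2) by (simp_all add: insert_commute)
  \<comment> \<open>Among any two vertices of \<open>p\<close> one is on the line, so at least two
    of the three are.\<close>
  have "\<exists>O' X' Y'. copy k O' X' Y' \<and> p = convex hull {O', X', Y'} \<and> g X' = 0 \<and> g Y' = 0"
  proof (cases "g x1 = 0")
    case True
    then show ?thesis
      using two[OF perm(1)] perm(3,4) copy_swap(2)[OF q(1)] copy_swap(2)[OF copy_swap(1)[OF q(1)]] by blast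
  next
    case False
    then show ?thesis using two[OF q(2)] two[OF perm(2)] q by blast
  qed
  then obtain O' X' Y' where O': "copy k O' X' Y'" "p = convex hull {O', X', Y'}" "g X' = 0" "g Y' = 0" by blast
  \<comment> \<open>Within \<open>t\<close> the line \<open>PQ\<close> does not extend beyond the
    segment, as \<open>P\<close> and \<open>Q\<close> are on the sides of \<open>t\<close>.\<close>
  have chord: "\<exists>s. w = P + s *\<^sub>R (Q - P) \<and> 0 \<le> s \<and> s \<le> 1" if w: "w \<in> t" "g w = 0" for w
  proof -
    obtain m n where mn: "w = v + m *\<^sub>R (X - v) + n *\<^sub>R (Y - v)" "0 \<le> m" "0 \<le> n"
      using w(1) convex_hull_3_iff[of w] t(2) by auto
    have w': "w = v + (m / x) *\<^sub>R (P - v) + (n / y) *\<^sub>R (Q - v)" using mn(1) PQ by simp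
    then have "m / x + n / y = 1" using gP[of "m / x" "n / y"] w(2) by simp
    then have mx: "m / x = 1 - n / y" by simp
    have "w = P + (n / y) *\<^sub>R (Q - P)" unfolding w' mx by (simp add: algebra_simps)
    moreover have "0 \<le> m / x" "0 \<le> n / y" using mn PQ by auto
    ultimately show ?thesis using mx by (intro exI[of _ "n / y"]) simp
  qed
  have "X' \<in> t" "Y' \<in> t" using O'(2) p(2) by (auto intro: hull_inc)
  then obtain i j where "X' = P + i *\<^sub>R (Q - P)" "0 \<le> i" "i \<le> 1" "Y' = P + j *\<^sub>R (Q - P)" "0 \<le> j" "j \<le> 1"
    using chord O'(3,4) by metis
  moreover have "dist P Q \<le> dist X' Y'" using copy_facts(3)[OF O'(1)] s(3) by simp
  moreover have "P \<noteq> Q" using e0 by (simp add: e_def)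
  ultimately have XY: "(X' = P \<and> Y' = Q) \<or> (X' = Q \<and> Y' = P)" by (rule segment_ends_of_dist)
  have cp: "copy k O' P Q" using XY O'(1) copy_swap(1) by blast
  have hp: "p = convex hull {O', P, Q}" using XY O'(2) by (auto simp: insert_commute)
  have "g O' \<noteq> 0"
  proof
    assume "g O' = 0"
    then have "cross2 e (O' - P) = 0" using ev by (simp add: g_def)
    then have "cross2 (P - O') (Q - O') = 0" by (simp add: e_def cross2_def algebra_simps)
    then show False using copy_facts(2)[OF cp] by (simp add: collinear_iff_cross2)
  qed
  moreover have "O' \<in> p" using hp by (auto intro: hull_inc)
  ultimately have "g O' < 0" using gp by force
  moreover have "O' \<notin> s" using gs \<open>g O' < 0\<close> by force
  ultimately show thesis using that hp cp by (simp add: g_def e_def)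
qed

text \<open>\<open>U\<close> and \<open>V\<close> are on the same side of the line
  \<open>PQ\<close>, so a point slightly off the midpoint of \<open>PQ\<close> on that side is
  interior to both triangles. The number \<open>d\<close> merely fixes the sign.\<close>

lemma opposite_tiles_overlap:
  assumes "cross2 (Q - P) (U - P) / d < 0" "cross2 (Q - P) (V - P) / d < 0"
  shows "interior (convex hull {U, P, Q}) \<inter> interior (convex hull {V, P, Q}) \<noteq> {}"
proof -
  define e where "e = Q - P"
  have nz: "cross2 e (U - P) \<noteq> 0" "cross2 e (V - P) \<noteq> 0" using assms by (auto simp: e_def)
  define \<tau> where "\<tau> = cross2 e (V - P) / cross2 e (U - P)"
  define \<kappa> where "\<kappa> = cross2 (V - P) (U - P) / cross2 e (U - P)"
  have \<tau>: "0 < \<tau>" using assms unfolding \<tau>_def e_def[symmetric]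
    by (auto simp: divide_less_0_iff zero_less_divide_iff)
  have V: "V - P = \<kappa> *\<^sub>R e + \<tau> *\<^sub>R (U - P)" unfolding \<tau>_def \<kappa>_def by (rule cross2_coordinates[OF nz(1)])
  \<comment> \<open>Makes the total shift of the coordinates 1/4, so that those starting at 1/2 and
    0 stay inside the coordinate triangle.\<close>
  define \<delta> where "\<delta> = 1 / (4 * (1 + \<bar>\<kappa>\<bar> + \<tau>))"
  have "0 < \<delta>" using \<tau> by (simp add: \<delta>_def)
  have "\<delta> * (1 + \<bar>\<kappa>\<bar> + \<tau>) = 1 / 4" using \<tau> by (simp add: \<delta>_def field_simps)
  then have "\<delta> + \<bar>\<delta> * \<kappa>\<bar> + \<delta> * \<tau> = 1 / 4" using \<open>0 < \<delta>\<close> by (simp add: algebra_simps abs_mult)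
  moreover have "0 < \<delta> * \<tau>" using \<open>0 < \<delta>\<close> \<tau> by simp
  ultimately have small: "\<delta> < 1 / 2" "0 < 1 / 2 + \<delta> * \<kappa>" "(1 / 2 + \<delta> * \<kappa>) + \<delta> * \<tau> < 1" "0 < \<delta> * \<tau>"
    using \<open>0 < \<delta>\<close> by (simp_all add: abs_if split: if_splits)
  define z where "z = P + (1 / 2) *\<^sub>R e + \<delta> *\<^sub>R (V - P)"
  have z: "z = P + (1 / 2 + \<delta> * \<kappa>) *\<^sub>R e + (\<delta> * \<tau>) *\<^sub>R (U - P)"
    by (simp add: z_def V algebra_simps)
  have "\<not> collinear {P, Q, U}" "\<not> collinear {P, Q, V}" using nz by (simp_all add: collinear_iff_cross2 e_def)
  note int = this[THEN interior_triangle_iff, of z]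
  have "z \<in> interior (convex hull {P, Q, U})"
    unfolding int e_def[symmetric] using z small by blast
  moreover have "z \<in> interior (convex hull {P, Q, V})"
    unfolding int e_def[symmetric]
    using z_def \<open>0 < \<delta>\<close> small by (intro exI[of _ "1 / 2"] exI[of _ \<delta>]) auto
  ultimately show ?thesis by (auto simp: insert_commute)
qed

section \<open>Ordered tilings\<close>

lemma copy_second_side:
  assumes "copy k x y z" "dist y z = k * a"
  shows "k * b \<le> dist x y"
proof -
  obtain h where h: "similarity k h" and xyz:
    "x = h A \<and> y = h B \<and> z = h C \<or> x = h A \<and> y = h C \<and> z = h B \<or>
     x = h B \<and> y = h A \<and> z = h C \<or> x = h B \<and> y = h C \<and> z = h A \<or>
     x = h C \<and> y = h A \<and> z = h B \<or> x = h C \<and> y = h B \<and> z = h A"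
    using assms unfolding copy_def by blast
  have d: "dist (h u) (h v) = k * dist u v" for u v using h by (simp add: similarity_def)
  have k: "0 < k" using h by (simp add: similarity_def)
  have comm: "dist C B = a" "dist C A = b" "dist B A = c" by (simp_all add: dist_commute)
  have "b \<le> c" "b = a \<Longrightarrow> b \<le> a" "c = a \<Longrightarrow> b \<le> a" using sides by simp_all
  then show ?thesis using xyz k assms(2) by (elim disjE conjE) (simp_all add: d comm)
qed

text \<open>Both tiles have the chord as a side and lie beyond it, so distinct ones would
  overlap.\<close>

lemma corner_unique_neighbour:
  assumes F: "tiling k F t" and t: "copy l v X Y" "t = convex hull {v, X, Y}" "angle_area v X Y = \<alpha>"
    and s: "s \<in> F" "v \<in> s" and p: "p \<in> F" "p \<noteq> s" "connected (interior (s \<union> p))"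
    and p': "p' \<in> F" "p' \<noteq> s" "connected (interior (s \<union> p'))"
  shows "p = p'"
proof -
  note F' = tilingD[OF F]
  obtain s' P Q x y where s': "s' \<in> F" "s' = convex hull {v, P, Q}" "copy k v P Q" "dist P Q = k * a"
    "P = v + x *\<^sub>R (X - v)" "Q = v + y *\<^sub>R (Y - v)" "0 < x" "0 < y" "{q \<in> F. v \<in> q} = {s'}"
    using corner_tile[OF F t] .
  have "s' = s" using s s'(9) by blast
  note c = corner_neighbour[OF copy_facts(2)[OF t(1)] t(2) s'(3,2,4-8), unfolded \<open>s' = s\<close>]
  have sub: "q \<subseteq> t" if "q \<in> F" for q using that F'(2) by blast
  obtain U where U: "p = convex hull {U, P, Q}" "cross2 (Q - P) (U - P) / cross2 (Q - P) (v - P) < 0"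
    using c[OF F'(3)[OF p(1)] sub[OF p(1)] sub[OF s(1)] F'(4)[OF s(1) p(1)] p(3)] p(2) by metis
  obtain V where V: "p' = convex hull {V, P, Q}" "cross2 (Q - P) (V - P) / cross2 (Q - P) (v - P) < 0"
    using c[OF F'(3)[OF p'(1)] sub[OF p'(1)] sub[OF s(1)] F'(4)[OF s(1) p'(1)] p'(3)] p'(2) by metis
  have "interior p \<inter> interior p' \<noteq> {}"
    unfolding U(1) V(1) by (rule opposite_tiles_overlap[OF U(2) V(2)])
  then show ?thesis using F'(4)[OF p(1) p'(1)] by blast
qed

text \<open>A tile containing \<open>P\<close> other than as a vertex would take up the whole
  straight angle at \<open>P\<close> and leave nothing for \<open>s\<close>. So all tiles at
  \<open>P\<close> have a vertex there, and their angles add up to the straight angle.\<close>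

lemma angles_around_edge_point:
  assumes F: "tiling k F t" and t: "has_angle t P half_disc_area"
    and s: "s \<in> F" "s = convex hull {P, y, z}" "\<not> collinear {P, y, z}"
  obtains f where "sum f F = half_disc_area" "\<forall>q\<in>F. has_angle q P (f q)" "\<forall>q\<in>F. P \<notin> q \<longrightarrow> f q = 0" "\<forall>q\<in>F. P \<in> q \<longrightarrow> \<alpha> \<le> f q"
    "\<forall>q\<in>F. P \<in> q \<longrightarrow> (\<exists>y z. copy k P y z \<and> q = convex hull {P, y, z} \<and> f q = angle_area P y z)"
proof -
  note F' = tilingD[OF F]
  have tF: "has_angle (\<Union>F) P half_disc_area" using t F'(2) by simp
  have ext: "P extreme_point_of q" if q: "q \<in> F" "P \<in> q" for q
  proof (rule ccontr)
    assume n: "\<not> P extreme_point_of q"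
    then have "s \<noteq> q" using extreme_point_of_triangle[OF s(3)] s(2) by blast
    \<comment> \<open>Lower bounds for the angles at \<open>P\<close> whose sum exceeds the straight
      angle.\<close>
    define g where "g r = (if r = q then half_disc_area else if r = s then angle_area P y z else 0)" for r
    have "angle_at_least r P (g r)" if "r \<in> F" for r
    proof -
      have "angle_at_least r P 0" by (simp add: angle_at_least_def)
      moreover have "angle_at_least s P (angle_area P y z)"
        unfolding s(2) by (rule has_angle_imp_at_least[OF has_angle_vertex[OF s(3)]])
      moreover have "angle_at_least q P half_disc_area"
        using tile_not_extreme[OF F'(3)[OF q(1)] q(2) n] .
      ultimately show ?thesis by (simp add: g_def)
    qed
    then have "sum g F \<le> half_disc_area"
      using has_angle_sum(2)[OF F'(1) tF tile_convex[OF F'(3)] F'(4)] by blast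
    moreover have "sum g {q, s} \<le> sum g F"
    proof (rule sum_mono2)
      have "0 < angle_area P y z"
        unfolding angle_area_def using s(3) by (intro sector_area_pos) (simp add: collinear_iff_cross2)
      then show "0 \<le> g r" for r by (simp add: g_def half_disc_area_def)
    qed (use F'(1) q s in auto)
    moreover have "sum g {q, s} = half_disc_area + angle_area P y z"
      using \<open>s \<noteq> q\<close> by (simp add: g_def)
    moreover have "0 < angle_area P y z"
      unfolding angle_area_def using s(3) by (intro sector_area_pos) (simp add: collinear_iff_cross2)
    ultimately show False by simp
  qed
  have "\<exists>g. has_angle q P g \<and> (P \<in> q \<longrightarrow> \<alpha> \<le> g \<and> (\<exists>y z. copy k P y z \<and> q = convex hull {P, y, z} \<and> g = angle_area P y z))
      \<and> (P \<notin> q \<longrightarrow> g = 0)" if q: "q \<in> F" for q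
  proof (cases "P \<in> q")
    case True
    obtain y z where "copy k P y z" "q = convex hull {P, y, z}"
      using tile_extreme[OF F'(3)[OF q] ext[OF q True]] .
    then show ?thesis using True has_angle_vertex copy_facts(2,5) by blast
  next
    case False
    then show ?thesis using has_angle_outside tile_closed[OF F'(3)[OF q]] by blast
  qed
  then obtain f where f: "\<And>q. q \<in> F \<Longrightarrow> has_angle q P (f q)"
    "\<And>q. q \<in> F \<Longrightarrow> P \<in> q \<Longrightarrow> \<alpha> \<le> f q \<and> (\<exists>y z. copy k P y z \<and> q = convex hull {P, y, z} \<and> f q = angle_area P y z)"
    "\<And>q. q \<in> F \<Longrightarrow> P \<notin> q \<Longrightarrow> f q = 0" by metis
  have "sum f F = half_disc_area"
    using has_angle_sum(1)[OF F'(1) tF tile_convex[OF F'(3)] F'(4)] f(1) by blast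
  then show thesis using f by (intro that[of f]) blast+
qed

text \<open>The tiles \<open>s\<close> and \<open>p\<close> leave a gap at \<open>P\<close> that has
  to be filled. A fourth tile would take another \<open>\<alpha>\<close>; the last conclusion
  records this as an inequality, to be refuted where the angles are known.\<close>

lemma obtain_third_tile:
  assumes F: "tiling k F t" and t: "has_angle t P half_disc_area"
    and s: "s \<in> F" "s = convex hull {P, y, z}" "\<not> collinear {P, y, z}"
    and p: "p \<in> F" "p = convex hull {P, y', z'}" "\<not> collinear {P, y', z'}" "s \<noteq> p"
    and less: "angle_area P y z + angle_area P y' z' < half_disc_area"
  obtains q u w where "q \<in> F" "q \<noteq> s" "q \<noteq> p" "q = convex hull {P, u, w}" "copy k P u w"
    "\<alpha> \<le> angle_area P u w"
    "angle_area P y z + angle_area P y' z' + angle_area P u w \<le> half_disc_area"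
    "\<forall>q'\<in>F. P \<in> q' \<longrightarrow> q' \<notin> {s, p, q} \<longrightarrow>
      angle_area P y z + angle_area P y' z' + \<alpha> + \<alpha> \<le> half_disc_area"
proof -
  note F' = tilingD[OF F]
  obtain f where f: "sum f F = half_disc_area" "\<forall>q\<in>F. has_angle q P (f q)" "\<forall>q\<in>F. P \<notin> q \<longrightarrow> f q = 0" "\<forall>q\<in>F. P \<in> q \<longrightarrow> \<alpha> \<le> f q"
    "\<forall>q\<in>F. P \<in> q \<longrightarrow> (\<exists>y z. copy k P y z \<and> q = convex hull {P, y, z} \<and> f q = angle_area P y z)"
    using angles_around_edge_point[OF F t s] .
  have fs: "f s = angle_area P y z"
    using has_angle_unique[OF f(2)[rule_format, OF s(1)]] has_angle_vertex[OF s(3)] s(2) by simp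
  have fp: "f p = angle_area P y' z'"
    using has_angle_unique[OF f(2)[rule_format, OF p(1)]] has_angle_vertex[OF p(3)] p(2) by simp
  have f0: "0 \<le> f q" if "q \<in> F" for q using f(3,4)[rule_format, OF that] angle_pos by force
  have "\<exists>q\<in>F - {s, p}. f q \<noteq> 0"
  proof (rule ccontr)
    assume "\<not> ?thesis"
    then have "sum f F = sum f {s, p}"
      using s p F'(1) by (intro sum.mono_neutral_right) auto
    then show False using f(1) fs fp p(4) less by simp
  qed
  then obtain q where q: "q \<in> F" "q \<noteq> s" "q \<noteq> p" "f q \<noteq> 0" by blast
  then have Pq: "P \<in> q" using f(3) by blast
  obtain u w where uw: "copy k P u w" "q = convex hull {P, u, w}" "f q = angle_area P u w"
    using f(5)[rule_format, OF q(1) Pq] by blast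
  have "sum f {s, p, q} \<le> sum f F" using s p q f0 F'(1) by (intro sum_mono2) auto
  then have le: "angle_area P y z + angle_area P y' z' + angle_area P u w \<le> half_disc_area"
    using f(1) fs fp uw(3) p(4) q by (simp add: add.assoc)
  have "angle_area P y z + angle_area P y' z' + \<alpha> + \<alpha> \<le> half_disc_area"
    if q': "q' \<in> F" "P \<in> q'" "q' \<notin> {s, p, q}" for q'
  proof -
    have "sum f {s, p, q, q'} \<le> sum f F" using s p q q' f0 F'(1) by (intro sum_mono2) auto
    moreover have "s \<notin> {p, q, q'}" "p \<notin> {q, q'}" "q \<notin> {q'}" using p(4) q(2,3) q'(3) by blast+
    ultimately have "f s + (f p + (f q + f q')) \<le> half_disc_area" using f(1) by simp
    then show ?thesis using fs fp f(4)[rule_format, OF q'(1,2)] f(4)[rule_format, OF q(1) Pq] by linarith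
  qed
  moreover have "\<alpha> \<le> angle_area P u w" using f(4)[rule_format, OF q(1) Pq] uw(3) by simp
  ultimately show thesis using q uw le by (intro that[of q u w]) blast+
qed

text \<open>At each end of the chord, \<open>s\<close> and \<open>p\<close> have the angle
  \<open>\<beta>\<close> or \<open>\<gamma>\<close>. If they are arranged alike, one end carries
  \<open>\<gamma>\<close> twice; the gap there holds at least \<open>\<alpha>\<close>, so
  \<open>2 * \<gamma> + \<alpha>\<close> is at most the angle sum and
  \<open>\<beta> = \<gamma>\<close>. In every case a gap of exactly \<open>\<alpha>\<close>
  remains.\<close>

lemma third_tile:
  assumes F: "tiling k F t" and t: "has_angle t P half_disc_area" "has_angle t Q half_disc_area"
    and s: "s \<in> F" "s = convex hull {v, P, Q}" "copy k v P Q"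
    and p: "p \<in> F" "p = convex hull {u, P, Q}" "copy k u P Q" "s \<noteq> p"
    and PQ: "dist P Q = k * a"
  obtains q y z where "q \<in> F" "q \<noteq> s" "q \<noteq> p" "{q' \<in> F. P \<in> q'} = {s, p, q}"
    "q = convex hull {P, y, z}" "copy k P y z" "angle_area P y z = \<alpha>"
proof -
  note sP = copy_facts(2)[OF copy_swap(2)[OF s(3)]] and sQ = copy_facts(2)[OF copy_swap(2)[OF copy_swap(1)[OF s(3)]]]
  note pP = copy_facts(2)[OF copy_swap(2)[OF p(3)]] and pQ = copy_facts(2)[OF copy_swap(2)[OF copy_swap(1)[OF p(3)]]]
  have hulls: "s = convex hull {P, v, Q}" "s = convex hull {Q, v, P}"
    "p = convex hull {P, u, Q}" "p = convex hull {Q, u, P}"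
    using s(2) p(2) by (simp_all add: insert_commute)
  \<comment> \<open>two largest angles leave a gap by acuteness, which must hold a further angle\<close>
  have eq: "\<beta> = \<gamma>" if h: "has_angle t R half_disc_area" "s = convex hull {R, v, R'}" "\<not> collinear {R, v, R'}"
    "p = convex hull {R, u, R'}" "\<not> collinear {R, u, R'}" "angle_area R v R' = \<gamma>" "angle_area R u R' = \<gamma>" for R R'
  proof -
    have less: "angle_area R v R' + angle_area R u R' < half_disc_area" using h(6,7) angle_acute by simp
    show ?thesis
    proof (rule obtain_third_tile[OF F h(1) s(1) h(2,3) p(1) h(4,5) p(4) less])
      fix x y
      assume "\<alpha> \<le> angle_area R x y" "angle_area R v R' + angle_area R u R' + angle_area R x y \<le> half_disc_area"
      then show ?thesis using h(6,7) angle_sum angle_order(2) by linarith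
    qed
  qed
  have sum: "angle_area P v Q + angle_area P u Q = \<beta> + \<gamma>"
    using copy_facts(7)[OF s(3) PQ] copy_facts(7)[OF p(3) PQ]
  proof (elim disjE conjE)
    assume *: "angle_area P v Q = \<beta>" "angle_area Q v P = \<gamma>" "angle_area P u Q = \<beta>" "angle_area Q u P = \<gamma>"
    have "\<beta> = \<gamma>" by (rule eq[OF t(2) hulls(2) sQ hulls(4) pQ *(2,4)])
    then show ?thesis using * by simp
  next
    assume *: "angle_area P v Q = \<gamma>" "angle_area P u Q = \<gamma>"
    have "\<beta> = \<gamma>" by (rule eq[OF t(1) hulls(1) sP hulls(3) pP *])
    then show ?thesis using * by simp
  qed simp_all
  then have "angle_area P v Q + angle_area P u Q < half_disc_area" using angle_sum angle_pos by linarith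
  then obtain q y z where q: "q \<in> F" "q \<noteq> s" "q \<noteq> p" "q = convex hull {P, y, z}" "copy k P y z"
    "\<alpha> \<le> angle_area P y z"
    "angle_area P v Q + angle_area P u Q + angle_area P y z \<le> half_disc_area"
    "\<forall>q'\<in>F. P \<in> q' \<longrightarrow> q' \<notin> {s, p, q} \<longrightarrow>
      angle_area P v Q + angle_area P u Q + \<alpha> + \<alpha> \<le> half_disc_area"
    by (rule obtain_third_tile[OF F t(1) s(1) hulls(1) sP p(1) hulls(3) pP p(4)])
  have "angle_area P y z = \<alpha>" using q(6,7) sum angle_sum by linarith
  moreover have "q' \<in> {s, p, q}" if "q' \<in> F" "P \<in> q'" for q'
    using q(8) that sum angle_sum angle_pos by force
  moreover have "P \<in> s" "P \<in> p" "P \<in> q" using hulls q(4) by (auto intro: hull_inc)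
  ultimately show thesis using that[of q y z] q s(1) p(1) by blast
qed

text \<open>Of the curve only the points \<open>e j\<close> remain, at which it passes from one tile
  to the next, so that reversing the curve amounts to reindexing. The bound on \<open>k\<close>
  expresses that there are at least two tiles.\<close>

lemma ordered_tiling_last_corner:
  assumes F: "tiling k F t" and t: "copy 1 v X Y" "t = convex hull {v, X, Y}" "angle_area v X Y = \<alpha>"
    and k: "2 * k\<^sup>2 \<le> 1"
    and N: "2 \<le> N" and \<tau>: "bij_betw \<tau> {..<N} F"
    and e: "\<And>j. j < N \<Longrightarrow> e j \<in> \<tau> j" "\<And>j. j < N \<Longrightarrow> e (Suc j) \<in> \<tau> j"
    and small: "\<And>j P y z. j < N \<Longrightarrow> \<tau> j = convex hull {P, y, z} \<Longrightarrow> copy k P y z \<Longrightarrow> angle_area P y z = \<alpha> \<Longrightarrow>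
      e j = P \<or> e (Suc j) = P"
    and conn: "\<And>j. Suc j < N \<Longrightarrow> connected (interior (\<tau> j \<union> \<tau> (Suc j)))"
    and v: "v \<in> \<tau> (N - 1)"
  shows False
proof -
  note F' = tilingD[OF F]
  have tlF: "\<tau> j \<in> F" if "j < N" for j using \<tau> that by (auto simp: bij_betw_def)
  have inj: "i = j" if "\<tau> i = \<tau> j" "i < N" "j < N" for i j
    using \<tau> that by (auto simp: bij_betw_def inj_on_def)
  define s p where "s = \<tau> (N - 1)" and "p = \<tau> (N - 2)"
  have sp: "s \<in> F" "p \<in> F" "s \<noteq> p" using N tlF inj[of "N - 1" "N - 2"] by (auto simp: s_def p_def)
  obtain s' P Q x y where s': "s' \<in> F" "s' = convex hull {v, P, Q}" "copy k v P Q" "dist P Q = k * a"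
    "P = v + x *\<^sub>R (X - v)" "Q = v + y *\<^sub>R (Y - v)" "0 < x" "0 < y" "{q \<in> F. v \<in> q} = {s'}"
    using corner_tile[OF F t] .
  have "s' = s" using v sp(1) s'(9) by (auto simp: s_def)
  note s = s'(1-8)[unfolded \<open>s' = s\<close>]
  have nc: "\<not> collinear {v, X, Y}" using copy_facts(2)[OF t(1)] .
  have sub: "q \<subseteq> t" if "q \<in> F" for q using that F'(2) by blast
  have "Suc (N - 2) = N - 1" using N by simp
  then have "connected (interior (s \<union> p))" using conn[of "N - 2"] N by (simp add: s_def p_def Un_commute)
  then obtain u where u: "p = convex hull {u, P, Q}" "copy k u P Q" "u \<notin> s"
    using corner_neighbour[OF nc t(2) s(3,2,4-8) F'(3)[OF sp(2)] sub[OF sp(2)] sub[OF sp(1)] F'(4)[OF sp]]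
    by blast
  \<comment> \<open>If the corner tile used up a whole side of \<open>t\<close>, then
    \<open>b \<le> k * c\<close>, so \<open>2 * b\<^sup>2 \<le> c\<^sup>2\<close>, whereas acuteness
    gives \<open>c\<^sup>2 < a\<^sup>2 + b\<^sup>2 \<le> 2 * b\<^sup>2\<close>.\<close>
  have lt1: "x < 1" if xy: "R = v + x *\<^sub>R (Z - v)" "0 < x" "dist v R \<le> k * c" "b \<le> dist v Z" for R Z x
  proof (rule ccontr)
    assume "\<not> x < 1"
    then have "1 * dist v Z \<le> x * dist v Z" by (intro mult_right_mono) auto
    also have "\<dots> = dist v R" using xy by (simp add: dist_norm norm_minus_commute)
    finally have "b \<le> k * c" using xy by simp
    then have "b\<^sup>2 \<le> (k * c)\<^sup>2" by (intro power_mono) auto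
    then have "2 * b\<^sup>2 \<le> (2 * k\<^sup>2) * c\<^sup>2" by (simp add: power_mult_distrib)
    also have "\<dots> \<le> 1 * c\<^sup>2" using k by (intro mult_right_mono) auto
    finally have "2 * b\<^sup>2 \<le> c\<^sup>2" by simp
    moreover have "a\<^sup>2 \<le> b\<^sup>2" using sides by (intro power_mono) auto
    ultimately show False using side_acute by linarith
  qed
  have dXY: "dist X Y = 1 * a" using copy_facts(6)[OF t(1)] t(3) by simp
  have x1: "x < 1"
    using lt1[OF s(5,7)] copy_second_side[OF t(1) dXY] copy_facts(4)[OF copy_swap(2)[OF copy_swap(1)[OF s(3)]]] by (simp add: dist_commute)
  have y1: "y < 1"
    using lt1[OF s(6,8)] copy_facts(4)[OF copy_swap(2)[OF s(3)]]
      copy_second_side[OF copy_swap(1)[OF t(1)]] dXY by (simp add: dist_commute)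
  have aP: "has_angle t P half_disc_area" unfolding t(2) by (rule has_angle_edge[OF nc s(5,7) x1])
  have aQ: "has_angle t Q half_disc_area"
  proof -
    have "\<not> collinear {v, Y, X}" using nc by (simp add: insert_commute)
    from has_angle_edge[OF this s(6,8) y1] show ?thesis unfolding t(2) by (simp add: insert_commute)
  qed
  \<comment> \<open>\<open>u\<close> is a small vertex of \<open>p\<close>; the curve leaves
    \<open>p\<close> at a point of \<open>s\<close>, which does not contain \<open>u\<close>, so it
    enters \<open>p\<close> at \<open>u\<close>.\<close>
  have eP: "e (N - 2) = u"
  proof -
    have "angle_area u P Q = \<alpha>" using copy_facts(6)[OF u(2)] s(4) by simp
    then have "e (N - 2) = u \<or> e (Suc (N - 2)) = u" using small[of "N - 2"] u N by (auto simp: p_def)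
    moreover have "e (Suc (N - 2)) \<in> s"
      using e(1)[of "N - 1"] N \<open>Suc (N - 2) = N - 1\<close> by (simp add: s_def)
    ultimately show ?thesis using u(3) by blast
  qed
  \<comment> \<open>The third tile at \<open>R\<close> is entered or left at \<open>R\<close>. If
    left there, its successor contains \<open>R\<close> and must be \<open>p\<close>, as
    \<open>s\<close> already follows \<open>p\<close>; but \<open>p\<close> is entered at
    \<open>u\<close>. If entered there, a predecessor would have to contain \<open>R\<close>, and
    none of the three tiles at \<open>R\<close> can be it.\<close>
  have start: "e 0 = R" if R: "q \<in> F" "q \<noteq> s" "q \<noteq> p" "{q' \<in> F. R \<in> q'} = {s, p, q}"
    "q = convex hull {R, y, z}" "copy k R y z" "angle_area R y z = \<alpha>" "R \<in> s" for R q y z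
  proof -
    obtain j where j: "j < N" "q = \<tau> j" using R(1) \<tau> by (auto simp: bij_betw_def)
    have jne: "j \<noteq> N - 1" "j \<noteq> N - 2" using R(2,3) j by (auto simp: s_def p_def)
    then have j': "Suc j < N" "Suc j \<noteq> N - 1" using j(1) N by auto
    have at: "i = N - 1 \<or> i = N - 2 \<or> i = j" if "i < N" "R \<in> \<tau> i" for i
    proof -
      have "\<tau> i \<in> {s, p, q}" using R(4) tlF[OF that(1)] that(2) by blast
      then show ?thesis using inj[OF _ that(1)] N j by (auto simp: s_def p_def)
    qed
    have "e j = R \<or> e (Suc j) = R" using small[OF j(1)] R j by metis
    moreover have "e (Suc j) \<noteq> R"
    proof
      assume "e (Suc j) = R"
      then have "Suc j = N - 2" using at[of "Suc j"] e(1)[of "Suc j"] j' by auto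
      then show False using eP \<open>e (Suc j) = R\<close> R(8) u(3) by simp
    qed
    ultimately have ej: "e j = R" by blast
    have "j = 0"
    proof (rule ccontr)
      assume "j \<noteq> 0"
      then have "R \<in> \<tau> (j - 1)" using e(2)[of "j - 1"] ej j by simp
      then show False using at[of "j - 1"] j j' jne \<open>j \<noteq> 0\<close> by linarith
    qed
    then show ?thesis using ej by simp
  qed
  have PQs: "P \<in> s" "Q \<in> s" using s(2) by (auto intro: hull_inc)
  obtain q y z where q: "q \<in> F" "q \<noteq> s" "q \<noteq> p" "{q' \<in> F. P \<in> q'} = {s, p, q}"
    "q = convex hull {P, y, z}" "copy k P y z" "angle_area P y z = \<alpha>"
    using third_tile[OF F aP aQ s(1,2,3) sp(2) u(1,2) sp(3) s(4)] .
  have "e 0 = P" using start[OF q PQs(1)] .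
  have hQ: "s = convex hull {v, Q, P}" "p = convex hull {u, Q, P}" using s(2) u(1) by (simp_all add: insert_commute)
  have dQ: "dist Q P = k * a" using s(4) by (simp add: dist_commute)
  obtain q y z where q: "q \<in> F" "q \<noteq> s" "q \<noteq> p" "{q' \<in> F. Q \<in> q'} = {s, p, q}"
    "q = convex hull {Q, y, z}" "copy k Q y z" "angle_area Q y z = \<alpha>"
    using third_tile[OF F aQ aP s(1) hQ(1) copy_swap(1)[OF s(3)] sp(2) hQ(2) copy_swap(1)[OF u(2)] sp(3) dQ] .
  have "e 0 = Q" using start[OF q PQs(2)] .
  then have "P = Q" using \<open>e 0 = P\<close> by simp
  then show False using copy_facts(2)[OF s(3)] by simp
qed

text \<open>The corner tile at \<open>A\<close> cannot have both a predecessor and a successor,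
  since they would coincide. So it comes last, or first, and then last in the reversed
  order.\<close>

lemma ordered_tiling_impossible:
  assumes F: "tiling k F T" and k: "2 * k\<^sup>2 \<le> 1"
    and N: "2 \<le> N" and \<tau>: "bij_betw \<tau> {..<N} F"
    and e: "\<And>j. j < N \<Longrightarrow> e j \<in> \<tau> j" "\<And>j. j < N \<Longrightarrow> e (Suc j) \<in> \<tau> j"
    and small: "\<And>j P y z. j < N \<Longrightarrow> \<tau> j = convex hull {P, y, z} \<Longrightarrow> copy k P y z \<Longrightarrow> angle_area P y z = \<alpha> \<Longrightarrow>
      e j = P \<or> e (Suc j) = P"
    and conn: "\<And>j. Suc j < N \<Longrightarrow> connected (interior (\<tau> j \<union> \<tau> (Suc j)))"
  shows False
proof -
  note F' = tilingD[OF F]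
  have tlF: "\<tau> j \<in> F" if "j < N" for j using \<tau> that by (auto simp: bij_betw_def)
  have inj: "i = j" if "\<tau> i = \<tau> j" "i < N" "j < N" for i j
    using \<tau> that by (auto simp: bij_betw_def inj_on_def)
  have t: "copy 1 A B C" using similarity_id unfolding copy_def by blast
  have "A \<in> \<Union>F" using F'(2) by (auto intro: hull_inc)
  then obtain i where i: "i < N" "A \<in> \<tau> i" using \<tau> unfolding bij_betw_def by blast
  consider "i = 0" | "i = N - 1" | "0 < i" "i < N - 1" using i by linarith
  then show False
  proof cases
    case 2
    then show False
      by (intro ordered_tiling_last_corner[OF F t refl refl k N \<tau> e small conn]) (use i in auto)
  next
    case 1
    \<comment> \<open>There is one more passage point than there are tiles, so the indices reverse
      differently.\<close>
    define e' \<tau>' where "e' j = e (N - j)" and "\<tau>' j = \<tau> (N - Suc j)" for j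
    have "bij_betw (\<lambda>j. N - Suc j) {..<N} {..<N}"
      by (rule bij_betw_byWitness[where f' = "\<lambda>j. N - Suc j"]) auto
    then have "bij_betw \<tau>' {..<N} F"
      using bij_betw_trans[OF _ \<tau>] unfolding \<tau>'_def comp_def by blast
    moreover have "e' j \<in> \<tau>' j" "e' (Suc j) \<in> \<tau>' j" if "j < N" for j
      using e(2)[of "N - Suc j"] e(1)[of "N - Suc j"] that by (simp_all add: e'_def \<tau>'_def Suc_diff_Suc)
    moreover have "e' j = P \<or> e' (Suc j) = P"
      if "j < N" "\<tau>' j = convex hull {P, y, z}" "copy k P y z" "angle_area P y z = \<alpha>" for j P y z
      using small[of "N - Suc j" P y z] that by (auto simp: e'_def \<tau>'_def Suc_diff_Suc)
    moreover have "connected (interior (\<tau>' j \<union> \<tau>' (Suc j)))" if "Suc j < N" for j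
      using conn[of "N - Suc (Suc j)"] that by (simp add: \<tau>'_def Suc_diff_Suc Un_commute)
    moreover have "A \<in> \<tau>' (N - 1)" using i 1 by (simp add: \<tau>'_def)
    ultimately show False
      by (rule ordered_tiling_last_corner[OF F t refl refl k N])
  next
    case 3
    have "\<tau> (i - 1) = \<tau> (Suc i)"
    proof (rule corner_unique_neighbour[OF F t refl refl tlF[OF i(1)] i(2)])
      show "\<tau> (i - 1) \<in> F" "\<tau> (Suc i) \<in> F" using 3 by (auto intro: tlF)
      show "\<tau> (i - 1) \<noteq> \<tau> i" using inj[of "i - 1" i] 3 by fastforce
      show "\<tau> (Suc i) \<noteq> \<tau> i" using inj[of "Suc i" i] i(1) 3 less_diff_conv[of i N 1] by auto
      show "connected (interior (\<tau> i \<union> \<tau> (i - 1)))" using conn[of "i - 1"] 3 by (simp add: Un_commute)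
      show "connected (interior (\<tau> i \<union> \<tau> (Suc i)))" using conn[of i] 3 by simp
    qed
    then have "i - 1 = Suc i" using 3 by (intro inj) auto
    then show False by simp
  qed
qed

end

section \<open>Curves based on reptilings\<close>

text \<open>The curve need not be injective, so areas replace preimages. If the smaller image took
  time outside \<open>[x, y]\<close>, that piece would add no area except a null set to what is
  traversed within \<open>[x, y]\<close>, contrary to area being proportional to time.\<close>

lemma traversal_order_interval_subset:
  assumes f: "traversal_order S f" "0 < measure lebesgue S"
    and I: "0 \<le> x" "x \<le> y" "y \<le> 1" "0 \<le> u" "u < w" "w \<le> 1" "f ` {u..w} \<subseteq> f ` {x..y}"
  shows "x \<le> u" "w \<le> y"
proof -
  define M where "M = measure lebesgue S"
  have M: "0 < M" using f(2) by (simp add: M_def)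
  have meas: "f ` {s..<t} \<in> lmeasurable" "measure lebesgue (f ` {s..<t}) = (t - s) * M" if "0 \<le> s" "s \<le> t" "t \<le> 1" for s t
    using f(1) that unfolding traversal_order_def M_def by blast+
  \<comment> \<open>Areas are given for half-open intervals; the end point of the closed one
    contributes the null set \<open>{f y}\<close>.\<close>
  have sub: "f ` {s..<t} \<subseteq> insert (f y) (f ` {x..<y})" if "u \<le> s" "t \<le> w" for s t
  proof -
    have "f ` {s..<t} \<subseteq> f ` {u..w}" using that by (intro image_mono) auto
    also have "\<dots> \<subseteq> f ` {x..y}" by (rule I)
    also have "{x..y} = insert y {x..<y}" using I(2) by auto
    finally show ?thesis by simp
  qed
  have bound: "(t - s) * M \<le> (y - x) * M + (t' - s') * M"
    if "0 \<le> s" "s \<le> t" "t \<le> 1" "0 \<le> s'" "s' \<le> t'" "t' \<le> 1"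
      "f ` {s..<t} \<subseteq> insert (f y) (f ` {x..<y}) \<union> f ` {s'..<t'}" for s t s' t'
  proof -
    have m: "insert (f y) (f ` {x..<y}) \<in> lmeasurable"
      "measure lebesgue (insert (f y) (f ` {x..<y})) \<le> measure lebesgue (f ` {x..<y})"
    proof -
      have *: "insert (f y) (f ` {x..<y}) = {f y} \<union> f ` {x..<y}" by simp
      have p: "{f y} \<in> lmeasurable" "measure lebesgue {f y} = 0"
        by (auto intro: measurable_convex negligible_imp_measure0)
      show "insert (f y) (f ` {x..<y}) \<in> lmeasurable"
        unfolding * using p(1) meas(1)[of x y] I by (intro fmeasurable.Un) auto
      show "measure lebesgue (insert (f y) (f ` {x..<y})) \<le> measure lebesgue (f ` {x..<y})"
        unfolding * using measure_Un_le[of "{f y}" lebesgue "f ` {x..<y}"] p meas(1)[of x y] I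
        by (auto dest: fmeasurableD)
    qed
    have "(t - s) * M = measure lebesgue (f ` {s..<t})" using meas that by simp
    also have "\<dots> \<le> measure lebesgue (insert (f y) (f ` {x..<y}) \<union> f ` {s'..<t'})"
      using that(7) meas(1)[OF that(1-3)] meas(1)[OF that(4-6)] m(1)
      by (intro measure_mono_fmeasurable fmeasurable.Un) (auto dest: fmeasurableD)
    also have "\<dots> \<le> measure lebesgue (insert (f y) (f ` {x..<y})) + measure lebesgue (f ` {s'..<t'})"
      using meas(1)[OF that(4-6)] m(1) by (intro measure_Un_le) (auto dest: fmeasurableD)
    also have "\<dots> \<le> (y - x) * M + (t' - s') * M"
      using m(2) meas(2)[OF that(4-6)] meas(2)[of x y] I by simp
    finally show ?thesis .
  qed
  show "x \<le> u"
  proof (rule ccontr)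
    assume "\<not> x \<le> u"
    \<comment> \<open>\<open>[u, q)\<close> is the part of \<open>[u, w]\<close> before
      \<open>x\<close>; the minimum covers the case that \<open>[u, w]\<close> ends before
      \<open>x\<close>.\<close>
    define q where "q = min w x"
    have q: "u < q" "q \<le> w" "q \<le> x" using \<open>\<not> x \<le> u\<close> I by (auto simp: q_def)
    have "{u..<y} = {u..<q} \<union> {q..<x} \<union> {x..<y}" using q I by auto
    then have "f ` {u..<y} \<subseteq> insert (f y) (f ` {x..<y}) \<union> f ` {q..<x}"
      using sub[of u q] q by (auto simp: image_Un)
    then have "(y - u) * M \<le> (y - x) * M + (x - q) * M"
      using q I by (intro bound) auto
    then have "(q - u) * M \<le> 0" by (simp add: algebra_simps)
    then show False using q M by (simp add: mult_le_0_iff)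
  qed
  show "w \<le> y"
  proof (rule ccontr)
    assume "\<not> w \<le> y"
    define q where "q = max u y"
    have q: "q < w" "u \<le> q" "y \<le> q" using \<open>\<not> w \<le> y\<close> I by (auto simp: q_def)
    have "{x..<w} = {x..<y} \<union> {y..<q} \<union> {q..<w}" using q I by auto
    then have "f ` {x..<w} \<subseteq> insert (f y) (f ` {x..<y}) \<union> f ` {y..<q}"
      using sub[of q w] q by (auto simp: image_Un)
    then have "(w - x) * M \<le> (y - x) * M + (q - y) * M"
      using q I by (intro bound) auto
    then have "(w - q) * M \<le> 0" by (simp add: algebra_simps)
    then show False using q M by (simp add: mult_le_0_iff)
  qed
qed

lemma traverses_one_by_oneE:
  assumes "traverses_one_by_one f F"
  obtains e \<tau> where "e 0 = 0" "e (card F) = 1" "\<forall>i j. i < j \<longrightarrow> j \<le> card F \<longrightarrow> e i < e j"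
    "\<forall>i j. i \<le> j \<longrightarrow> j \<le> card F \<longrightarrow> e i \<le> e j" "\<forall>j\<le>card F. 0 \<le> e j \<and> e j \<le> (1::real)"
    "bij_betw \<tau> {..<card F} F" "\<forall>j<card F. f ` {e j..e (Suc j)} = \<tau> j"
proof -
  obtain e \<tau> where e: "e 0 = 0" "e (card F) = 1" "strict_mono_on {..card F} e"
    "bij_betw \<tau> {..<card F} F" "\<forall>j<card F. f ` {e j..e (Suc j)} = \<tau> j"
    using assms unfolding traverses_one_by_one_def by blast
  have less: "\<forall>i j. i < j \<longrightarrow> j \<le> card F \<longrightarrow> e i < e j"
    using e(3) unfolding strict_mono_on_def by simp
  then have le: "\<forall>i j. i \<le> j \<longrightarrow> j \<le> card F \<longrightarrow> e i \<le> e j"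
    by (auto simp: le_less)
  then have "\<forall>j\<le>card F. 0 \<le> e j \<and> e j \<le> 1"
    using e(1,2) by (metis le0 order_refl)
  then show thesis using that e less le by blast
qed

section \<open>Scale and size of tiles\<close>

context sorted_acute_triangle
begin

lemma tile_iff: "tile k q \<longleftrightarrow> (\<exists>h. similarity k h \<and> q = h ` T)"
proof
  assume "tile k q"
  then obtain x y z where "copy k x y z" "q = convex hull {x, y, z}" by (rule tileE)
  moreover from this(1) obtain h where h: "similarity k h" and xyz:
    "x = h A \<and> y = h B \<and> z = h C \<or> x = h A \<and> y = h C \<and> z = h B \<or>
     x = h B \<and> y = h A \<and> z = h C \<or> x = h B \<and> y = h C \<and> z = h A \<or>
     x = h C \<and> y = h A \<and> z = h B \<or> x = h C \<and> y = h B \<and> z = h A"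
    unfolding copy_def by blast
  moreover have "{x, y, z} = {h A, h B, h C}" using xyz by (elim disjE conjE) (simp_all add: insert_commute)
  ultimately have "q = h ` T" using similarity_convex_hull[OF h, of "{A, B, C}"] by simp
  then show "\<exists>h. similarity k h \<and> q = h ` T" using h by blast
next
  assume "\<exists>h. similarity k h \<and> q = h ` T"
  then obtain h where h: "similarity k h" "q = h ` T" by blast
  then have "q = convex hull {h A, h B, h C}" using similarity_convex_hull[OF h(1), of "{A, B, C}"] by simp
  moreover have "copy k (h A) (h B) (h C)" using h(1) unfolding copy_def by blast
  ultimately show "tile k q" unfolding tile_def by blast
qed

lemma tile_T: "tile 1 T"
  unfolding tile_iff using similarity_id by force

lemma tile_lmeasurable: "tile k q \<Longrightarrow> q \<in> lmeasurable"
  by (intro measurable_convex tile_convex compact_imp_bounded tile_compact)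

lemma tile_measure_pos:
  assumes "tile k q"
  shows "0 < measure lebesgue q"
  using measure_pos_open[OF open_interior tile_interior[OF assms] interior_subset tile_lmeasurable[OF assms]] .

lemma tile_dist_le:
  assumes "tile k q" "x \<in> q" "y \<in> q"
  shows "dist x y \<le> k * diameter T"
proof -
  obtain h where h: "similarity k h" "q = h ` T" using assms(1) tile_iff by blast
  obtain x' y' where "x' \<in> T" "y' \<in> T" "x = h x'" "y = h y'" using assms(2,3) h(2) by blast
  moreover have "bounded T" using tile_compact[OF tile_T] by (rule compact_imp_bounded)
  ultimately show ?thesis
    using h(1) diameter_bounded_bound[of T x' y'] by (auto simp: similarity_def)
qed

text \<open>The \<open>r\<close> congruent tiles share the area of \<open>t\<close> equally, and
  areas scale with the square of the similarity ratio.\<close>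

lemma reptiling_tile:
  assumes "tile k t" "reptiling r t U" "u \<in> U"
  shows "tile (k / sqrt (real r)) u"
proof -
  have U: "2 \<le> r" "finite U" "card U = r" "\<Union>U = t" "\<And>u. u \<in> U \<Longrightarrow> similar t u"
    "\<And>s u. s \<in> U \<Longrightarrow> u \<in> U \<Longrightarrow> s \<noteq> u \<Longrightarrow> interior s \<inter> interior u = {}"
    "\<And>s u. s \<in> U \<Longrightarrow> u \<in> U \<Longrightarrow> congruent_sets s u"
    using assms(2) unfolding reptiling_def gentiling_def by simp_all
  obtain g where g: "similarity k g" "t = g ` T" using assms(1) tile_iff by blast
  have tl: "\<exists>l. tile (l * k) s \<and> measure lebesgue s = l\<^sup>2 * measure lebesgue t \<and> 0 < l" if s: "s \<in> U" for s
  proof -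
    obtain h l where h: "similarity l h" "s = h ` t"
      using U(5)[OF s] unfolding similar_def similarity_def by blast
    have "s = (\<lambda>x. h (g x)) ` T" using h(2) g(2) by (simp add: image_image)
    then have "tile (l * k) s" using similarity_compose[OF h(1) g(1)] tile_iff by blast
    moreover have "measure lebesgue s = l\<^sup>2 * measure lebesgue t"
      using similarity_measure[OF h(1) tile_lmeasurable[OF assms(1)]] h(2) by simp
    ultimately show ?thesis using h(1) by (auto simp: similarity_def)
  qed
  have mt: "measure lebesgue s = measure lebesgue u" if s: "s \<in> U" for s
  proof -
    obtain h where h: "similarity 1 h" "s = h ` u"
      using U(7)[OF assms(3) s] unfolding congruent_sets_def similarity_def by auto
    obtain l where "tile l u" using tl[OF assms(3)] by blast
    then show ?thesis using similarity_measure[OF h(1) tile_lmeasurable] h(2) by simp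
  qed
  have "measure lebesgue (\<Union>U \<inter> t) = (\<Sum>s\<in>U. measure lebesgue (s \<inter> t))"
  proof (rule measure_Union_Int_interior_disjoint[OF U(2) _ U(6)])
    show "convex s" if "s \<in> U" for s using tl[OF that] tile_convex by blast
    show "convex t" "bounded t" using assms(1) tile_convex tile_compact compact_imp_bounded by blast+
  qed
  moreover have "(\<Sum>s\<in>U. measure lebesgue (s \<inter> t)) = (\<Sum>s\<in>U. measure lebesgue s)"
    using U(4) by (intro sum.cong refl arg_cong[where f = "measure lebesgue"]) blast
  ultimately have "measure lebesgue t = (\<Sum>s\<in>U. measure lebesgue s)" using U(4) by simp
  also have "\<dots> = real r * measure lebesgue u" using mt U(3) by simp
  finally have tu: "measure lebesgue t = real r * measure lebesgue u" .
  obtain l where l: "tile (l * k) u" "measure lebesgue u = l\<^sup>2 * measure lebesgue t" "0 < l"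
    using tl[OF assms(3)] by blast
  have "real r * l\<^sup>2 = 1" using tu l(2) tile_measure_pos[OF assms(1)] by simp
  then have "(sqrt (real r) * l)\<^sup>2 = 1" by (simp add: power_mult_distrib)
  then have "sqrt (real r) * l = 1" using l(3) by (simp add: power2_eq_1_iff) (smt (verit) real_sqrt_ge_zero mult_nonneg_nonneg of_nat_0_le_iff)
  then have "l * k = k / sqrt (real r)" using U(1) by (simp add: field_simps)
  then show ?thesis using l(1) by simp
qed

end

section \<open>Levels of the construction\<close>

locale reptiling_curve = sorted_acute_triangle +
  fixes f :: "real \<Rightarrow> plane" and \<T> :: "nat \<Rightarrow> plane set set" and G :: "nat \<Rightarrow> plane set \<Rightarrow> plane set set"
    and r :: nat
  assumes face: "face_continuous T f"
    and construction: "gentiling_construction T f \<T> G"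
    and reptiling: "reptiling r T (\<T> 0)" "\<And>i t. t \<in> \<T> i \<Longrightarrow> reptiling r t (G i t)"
begin

definition \<rho> :: real where "\<rho> = 1 / sqrt (real r)"

lemma r_ge_2: "2 \<le> r"
  using reptiling(1) by (simp add: reptiling_def gentiling_def)

lemma \<rho>_bounds: "0 < \<rho>" "\<rho> < 1" "2 * \<rho>\<^sup>2 \<le> 1"
proof -
  have "1 < sqrt (real r)" using r_ge_2 by simp
  then show "0 < \<rho>" "\<rho> < 1" by (simp_all add: \<rho>_def)
  show "2 * \<rho>\<^sup>2 \<le> 1" using r_ge_2 by (simp add: \<rho>_def power_divide)
qed

lemma refine: "\<T> (Suc m) = (\<Union>t\<in>\<T> m. G m t)"
  using construction by (simp add: gentiling_construction_def)

lemma traverses: "traverses_one_by_one f (\<T> m)"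
  using construction by (simp add: gentiling_construction_def)

lemma tile_level: "s \<in> \<T> m \<Longrightarrow> tile (\<rho> ^ Suc m) s"
proof (induction m arbitrary: s)
  case 0
  then show ?case using reptiling_tile[OF tile_T reptiling(1)] by (simp add: \<rho>_def)
next
  case (Suc m)
  then obtain t where t: "t \<in> \<T> m" "s \<in> G m t" using refine by blast
  then show ?case using reptiling_tile[OF Suc.IH[OF t(1)] reptiling(2)[OF t(1)] t(2)] by (simp add: \<rho>_def)
qed

lemma tiling_level: "tiling (\<rho> ^ Suc m) (\<T> m) T"
proof -
  obtain r' where "gentiling r' T (\<T> m)"
    using construction unfolding gentiling_construction_def by blast
  then show ?thesis using tile_level unfolding tiling_def gentiling_def by simp
qed

lemma level_subset: "s \<in> \<T> m \<Longrightarrow> \<exists>t\<in>\<T> 0. s \<subseteq> t"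
proof (induction m arbitrary: s)
  case (Suc m)
  then obtain t where t: "t \<in> \<T> m" "s \<in> G m t" using refine by blast
  have "\<Union>(G m t) = t" using reptiling(2)[OF t(1)] by (simp add: reptiling_def gentiling_def)
  then have "s \<subseteq> t" using t(2) by blast
  then show ?case using Suc.IH[OF t(1)] by blast
qed blast

lemma level_cover: "t \<in> \<T> 0 \<Longrightarrow> z \<in> t \<Longrightarrow> \<exists>s\<in>\<T> m. s \<subseteq> t \<and> z \<in> s"
proof (induction m)
  case (Suc m)
  then obtain s where s: "s \<in> \<T> m" "s \<subseteq> t" "z \<in> s" by blast
  have G: "\<Union>(G m s) = s" using reptiling(2)[OF s(1)] by (simp add: reptiling_def gentiling_def)
  then obtain s' where "s' \<in> G m s" "z \<in> s'" using s(3) by blast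
  moreover have "s' \<subseteq> s" using G \<open>s' \<in> G m s\<close> by blast
  moreover have "s' \<in> \<T> (Suc m)" unfolding refine using s(1) \<open>s' \<in> G m s\<close> by blast
  ultimately show ?case using s(2) \<open>z \<in> s'\<close> by blast
qed blast

text \<open>Every refinement takes place inside the tiles, so deeper tiles never straddle the
  boundary of \<open>t\<close>.\<close>

lemma tiling_sublevel:
  assumes "t \<in> \<T> 0"
  shows "tiling (\<rho> ^ Suc m) {s \<in> \<T> m. s \<subseteq> t} t"
proof -
  have "\<Union>{s \<in> \<T> m. s \<subseteq> t} = t" using level_cover[OF assms] by blast
  then show ?thesis using tiling_level[of m] unfolding tiling_def by auto
qed

lemma traversal: "traversal_order T f"
  using face by (simp add: face_continuous_def space_filling_curve_def)

lemma connected_consecutive: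
  assumes "0 \<le> x" "x \<le> y" "y \<le> z" "z \<le> 1"
  shows "connected (interior (f ` {x..y} \<union> f ` {y..z}))"
proof -
  have "{x..z} = {x..y} \<union> {y..z}" using assms by auto
  then have "f ` {x..y} \<union> f ` {y..z} = f ` {x..z}" by (simp add: image_Un)
  moreover have "is_interval {x..z}" "{x..z} \<subseteq> {0..1}" using assms by (auto simp: is_interval_cc)
  ultimately show ?thesis using face by (simp add: face_continuous_def)
qed

text \<open>One level deep enough suffices. If neither end point is \<open>P\<close>, the tile at
  \<open>P\<close> of a sufficiently fine level misses both, so its predecessor and its successor
  still lie in the same first-level tile. Both would have to be the unique neighbour of that corner
  tile.\<close>

lemma small_corner_visited_at_end:
  assumes t: "f ` {x..y} \<in> \<T> 0" "0 \<le> x" "x \<le> y" "y \<le> 1"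
    and corner: "f ` {x..y} = convex hull {P, Y, Z}" "copy k P Y Z" "angle_area P Y Z = \<alpha>"
  shows "f x = P \<or> f y = P"
proof (rule ccontr)
  assume n: "\<not> (f x = P \<or> f y = P)"
  define d where "d = min (dist (f x) P) (dist (f y) P)"
  have d: "0 < d" using n by (simp add: d_def)
  have "((\<lambda>m. \<rho> ^ m * (\<rho> * diameter T)) \<longlongrightarrow> 0 * (\<rho> * diameter T)) sequentially"
    by (intro tendsto_mult tendsto_const LIMSEQ_realpow_zero) (use \<rho>_bounds in auto)
  then have "((\<lambda>m. \<rho> ^ Suc m * diameter T) \<longlongrightarrow> 0) sequentially" by (simp add: ac_simps)
  then have "\<forall>\<^sub>F m in sequentially. \<rho> ^ Suc m * diameter T < d"
    using d by (rule order_tendstoD(2))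
  then obtain m where m: "\<rho> ^ Suc m * diameter T < d"
    unfolding eventually_sequentially by blast
  let ?t = "f ` {x..y}"
  define F where "F = {s \<in> \<T> m. s \<subseteq> ?t}"
  have F: "tiling (\<rho> ^ Suc m) F ?t" unfolding F_def by (rule tiling_sublevel[OF t(1)])
  have "P \<in> ?t" using corner(1) by (auto intro: hull_inc)
  then obtain s where s: "s \<in> F" "P \<in> s" using tilingD(2)[OF F] by blast
  have noend: "f x \<notin> s" "f y \<notin> s"
    using tile_dist_le[OF tilingD(3)[OF F s(1)] _ s(2)] m by (force simp: d_def)+
  define N where "N = card (\<T> m)"
  obtain e \<tau> where e: "e 0 = 0" "e N = 1" "\<forall>i j. i < j \<longrightarrow> j \<le> N \<longrightarrow> e i < e j"
    "\<forall>i j. i \<le> j \<longrightarrow> j \<le> N \<longrightarrow> e i \<le> e j" "\<forall>j\<le>N. 0 \<le> e j \<and> e j \<le> 1"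
    "bij_betw \<tau> {..<N} (\<T> m)" "\<forall>j<N. f ` {e j..e (Suc j)} = \<tau> j"
    unfolding N_def using traverses_one_by_oneE[OF traverses[of m]] .
  note e_less = e(3)[rule_format] and e_le = e(4)[rule_format]
  have e01: "0 \<le> e j" "e j \<le> 1" if "j \<le> N" for j using e(5) that by blast+
  have \<tau>: "\<tau> j \<in> \<T> m" "f ` {e j..e (Suc j)} = \<tau> j" if "j < N" for j
    using e(6,7) that by (auto simp: bij_betw_def)
  have inj: "i = j" if "\<tau> i = \<tau> j" "i < N" "j < N" for i j
    using e(6) that by (auto simp: bij_betw_def inj_on_def)
  have "s \<subseteq> ?t" "s \<in> \<T> m" using s by (auto simp: F_def)
  moreover have "\<tau> ` {..<N} = \<T> m" using e(6) by (simp add: bij_betw_def)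
  ultimately obtain i where i: "i < N" "s = \<tau> i" by blast
  have MT: "0 < measure lebesgue T" by (rule tile_measure_pos[OF tile_T])
  note sub = traversal_order_interval_subset[OF traversal MT]
  \<comment> \<open>Containment of the images implies containment of the time intervals.\<close>
  have xi: "x \<le> e i" "e (Suc i) \<le> y"
    using sub[OF t(2-4), of "e i" "e (Suc i)"] \<open>s \<subseteq> ?t\<close> \<tau>(2)[OF i(1)] i e01 e_less[of i "Suc i"] by auto
  have "e i \<noteq> x" "e (Suc i) \<noteq> y"
    using noend \<tau>(2)[OF i(1)] i(2) e_le[of i "Suc i"] i(1) by auto
  then have strict: "x < e i" "e (Suc i) < y" using xi by auto
  have "0 < i" using strict(1) e(1) t(2) by (cases i) auto
  have "Suc i \<noteq> N" using strict(2) e(2) t(4) by auto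
  then have "Suc i < N" using i by simp
  \<comment> \<open>The time interval of a fine tile lies in that of its first-level ancestor.
    First-level intervals overlap only in end points, so an overlap with the open interval from
    \<open>x\<close> to \<open>y\<close> identifies the ancestor as \<open>?t\<close>.\<close>
  have inF: "\<tau> j \<in> F" if j: "j < N" "x < e (Suc j)" "e j < y" for j
  proof -
    obtain t' where t': "t' \<in> \<T> 0" "\<tau> j \<subseteq> t'" using level_subset[OF \<tau>(1)[OF j(1)]] by blast
    define N0 where "N0 = card (\<T> 0)"
    obtain c \<sigma> where c: "c 0 = 0" "c N0 = 1" "\<forall>i j. i < j \<longrightarrow> j \<le> N0 \<longrightarrow> c i < c j"
      "\<forall>i j. i \<le> j \<longrightarrow> j \<le> N0 \<longrightarrow> c i \<le> c j" "\<forall>j\<le>N0. 0 \<le> c j \<and> c j \<le> 1"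
      "bij_betw \<sigma> {..<N0} (\<T> 0)" "\<forall>j<N0. f ` {c j..c (Suc j)} = \<sigma> j"
      unfolding N0_def using traverses_one_by_oneE[OF traverses[of 0]] .
    note c_le = c(4)[rule_format]
    have c01: "0 \<le> c j" "c j \<le> 1" if "j \<le> N0" for j using c(5) that by blast+
    have \<sigma>: "\<sigma> ` {..<N0} = \<T> 0" using c(6) by (simp add: bij_betw_def)
    obtain n where n: "n < N0" "?t = \<sigma> n" using t(1) \<sigma> by blast
    obtain n' where n': "n' < N0" "t' = \<sigma> n'" using t'(1) \<sigma> by blast
    have fn: "f ` {c n..c (Suc n)} = ?t" "f ` {c n'..c (Suc n')} = t'" using c(7) n n' by auto
    have xy: "x < y" using strict e_less[of i "Suc i"] i(1) by simp
    have **: "c n \<le> x" "y \<le> c (Suc n)"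
      using sub[of "c n" "c (Suc n)" x y] fn(1) c01 c_le[of n "Suc n"] n(1) xy t by auto
    have J: "c n' \<le> e j" "e (Suc j) \<le> c (Suc n')"
      using sub[of "c n'" "c (Suc n')" "e j" "e (Suc j)"] t'(2) fn(2) \<tau>(2)[OF j(1)] c01 c_le[of n' "Suc n'"] n'(1)
        e01 e_less[of j "Suc j"] j(1) by auto
    have "n' = n"
    proof (rule ccontr)
      assume "n' \<noteq> n"
      then consider "Suc n' \<le> n" | "Suc n \<le> n'" by linarith
      then show False
      proof cases
        case 1
        then have "c (Suc n') \<le> c n" using n(1) by (intro c_le) auto
        then show False using J ** j(2) by linarith
      next
        case 2
        then have "c (Suc n) \<le> c n'" using n'(1) by (intro c_le) auto
        then show False using J ** j(3) by linarith
      qed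
    qed
    then have "\<tau> j \<subseteq> ?t" using t'(2) n n' by simp
    then show ?thesis using \<tau>(1)[OF j(1)] by (simp add: F_def)
  qed
  have "\<tau> (i - 1) = \<tau> (Suc i)"
  proof (rule corner_unique_neighbour[OF F corner(2,1,3) s])
    have "e (i - 1) < e i" using e_less[of "i - 1" i] i \<open>0 < i\<close> by simp
    moreover have "e i < e (Suc i)" using e_less[of i "Suc i"] i by simp
    ultimately show "\<tau> (i - 1) \<in> F" using inF[of "i - 1"] i strict \<open>0 < i\<close> by simp
    have "e (Suc i) < e (Suc (Suc i))" using e_less[of "Suc i" "Suc (Suc i)"] \<open>Suc i < N\<close> by simp
    then show "\<tau> (Suc i) \<in> F" using inF[of "Suc i"] \<open>Suc i < N\<close> strict xi \<open>e i < e (Suc i)\<close> by simp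
    have "i - 1 \<noteq> i" "Suc i \<noteq> i" using \<open>0 < i\<close> by auto
    moreover have "i - 1 < N" using i(1) by simp
    ultimately show "\<tau> (i - 1) \<noteq> s" "\<tau> (Suc i) \<noteq> s"
      unfolding i(2) using inj[OF _ _ i(1)] \<open>Suc i < N\<close> by blast+
    have "connected (interior (f ` {e (i - 1)..e i} \<union> f ` {e i..e (Suc i)}))"
      using i \<open>0 < i\<close> by (intro connected_consecutive e01 e_le) auto
    then show "connected (interior (s \<union> \<tau> (i - 1)))"
      using \<tau>(2)[of "i - 1"] \<tau>(2)[OF i(1)] i \<open>0 < i\<close> by (simp add: Un_commute)
    have "connected (interior (f ` {e i..e (Suc i)} \<union> f ` {e (Suc i)..e (Suc (Suc i))}))"
      using \<open>Suc i < N\<close> by (intro connected_consecutive e01 e_le) auto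
    then show "connected (interior (s \<union> \<tau> (Suc i)))"
      using \<tau>(2)[OF \<open>Suc i < N\<close>] \<tau>(2)[OF i(1)] i by simp
  qed
  then have "i - 1 = Suc i" using inj[of "i - 1" "Suc i"] i \<open>Suc i < N\<close> by simp
  then show False by simp
qed

lemma no_reptiling_curve: False
proof -
  define N where "N = card (\<T> 0)"
  obtain e \<tau> where e: "e 0 = 0" "e N = 1" "\<forall>i j. i < j \<longrightarrow> j \<le> N \<longrightarrow> e i < e j"
    "\<forall>i j. i \<le> j \<longrightarrow> j \<le> N \<longrightarrow> e i \<le> e j" "\<forall>j\<le>N. 0 \<le> e j \<and> e j \<le> 1"
    "bij_betw \<tau> {..<N} (\<T> 0)" "\<forall>j<N. f ` {e j..e (Suc j)} = \<tau> j"
    unfolding N_def using traverses_one_by_oneE[OF traverses[of 0]] .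
  note e_less = e(3)[rule_format] and e_le = e(4)[rule_format]
  have e01: "0 \<le> e j" "e j \<le> 1" if "j \<le> N" for j using e(5) that by blast+
  have N: "2 \<le> N" using reptiling(1) by (auto simp: N_def reptiling_def gentiling_def)
  have \<tau>: "\<tau> j \<in> \<T> 0" "f ` {e j..e (Suc j)} = \<tau> j" if "j < N" for j
    using e(6,7) that by (auto simp: bij_betw_def)
  have F: "tiling \<rho> (\<T> 0) T" using tiling_level[of 0] by simp
  show False
  proof (rule ordered_tiling_impossible[OF F \<rho>_bounds(3) N, of \<tau> "\<lambda>j. f (e j)"])
    show "bij_betw \<tau> {..<N} (\<T> 0)" using e(6) .
    show "f (e j) \<in> \<tau> j" "f (e (Suc j)) \<in> \<tau> j" if "j < N" for j
      using \<tau>(2)[OF that] e_le[of j "Suc j"] that by auto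
    show "f (e j) = P \<or> f (e (Suc j)) = P"
      if "j < N" "\<tau> j = convex hull {P, y, z}" "copy \<rho> P y z" "angle_area P y z = \<alpha>" for j P y z
    proof (rule small_corner_visited_at_end)
      show "f ` {e j..e (Suc j)} \<in> \<T> 0" "f ` {e j..e (Suc j)} = convex hull {P, y, z}"
        using \<tau>[OF that(1)] that(2) by simp_all
    qed (use that e01 e_le[of j "Suc j"] in simp_all)
    show "connected (interior (\<tau> j \<union> \<tau> (Suc j)))" if "Suc j < N" for j
    proof -
      have "connected (interior (f ` {e j..e (Suc j)} \<union> f ` {e (Suc j)..e (Suc (Suc j))}))"
        using that by (intro connected_consecutive e01 e_le) auto
      then show ?thesis using \<tau>(2)[of j] \<tau>(2)[of "Suc j"] that by simp
    qed
  qed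
qed

end

section \<open>Acute triangles with sorted sides\<close>

lemma vertex_angle_acute:
  assumes "vertex_angle x y z < pi / 2" "x \<noteq> y" "z \<noteq> y"
  shows "0 < (x - y) \<bullet> (z - y)"
proof (rule ccontr)
  assume n: "\<not> ?thesis"
  define q where "q = ((x - y) \<bullet> (z - y)) / (norm (x - y) * norm (z - y))"
  \<comment> \<open>Cauchy-Schwarz keeps the quotient in the range [-1, 1], on which
    \<open>arccos\<close> is antitone.\<close>
  have "\<bar>(x - y) \<bullet> (z - y)\<bar> \<le> norm (x - y) * norm (z - y)" by (rule Cauchy_Schwarz_ineq2)
  then have "-1 \<le> q" using assms by (simp add: q_def divide_simps)
  moreover have "q \<le> 0" using n by (simp add: q_def divide_le_0_iff)
  ultimately have "arccos 0 \<le> arccos q" by (intro arccos_le_arccos) auto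
  then show False using assms(1) by (simp add: vertex_angle_def q_def)
qed

lemma acute_triangle_sorted:
  assumes "acute_triangle T"
  obtains A B C where "sorted_acute_triangle A B C" "T = convex hull {A, B, C}"
proof -
  obtain x y z where T: "\<not> collinear {x, y, z}" "T = convex hull {x, y, z}"
    "vertex_angle y x z < pi / 2" "vertex_angle x y z < pi / 2" "vertex_angle x z y < pi / 2"
    using assms unfolding acute_triangle_def by blast
  have "x \<noteq> y" "x \<noteq> z" "y \<noteq> z" using T(1) by (auto simp: insert_commute)
  then have acute: "0 < (y - x) \<bullet> (z - x)" "0 < (x - y) \<bullet> (z - y)" "0 < (x - z) \<bullet> (y - z)"
    using T(3-5) by (auto intro: vertex_angle_acute)
  then have acute': "0 < (z - x) \<bullet> (y - x)" "0 < (z - y) \<bullet> (x - y)" "0 < (y - z) \<bullet> (x - z)"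
    by (simp_all add: inner_commute)
  define p q s where "p = dist y z" and "q = dist x z" and "s = dist x y"
  have d: "dist y z = p" "dist z y = p" "dist x z = q" "dist z x = q" "dist x y = s" "dist y x = s"
    by (simp_all add: p_def q_def s_def dist_commute)
  have nc: "\<not> collinear {x, z, y}" "\<not> collinear {y, x, z}" "\<not> collinear {y, z, x}"
    "\<not> collinear {z, x, y}" "\<not> collinear {z, y, x}"
    using T(1) by (simp_all add: insert_commute)
  have hull: "T = convex hull {x, z, y}" "T = convex hull {y, x, z}" "T = convex hull {y, z, x}"
    "T = convex hull {z, x, y}" "T = convex hull {z, y, x}"
    using T(2) by (simp_all add: insert_commute)
  \<comment> \<open>Each order of the sides determines a labelling with the longest side opposite to
    \<open>C\<close>.\<close>
  consider "p \<le> q" "q \<le> s" | "p \<le> s" "s \<le> q" | "q \<le> p" "p \<le> s" | "q \<le> s" "s \<le> p"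
    | "s \<le> p" "p \<le> q" | "s \<le> q" "q \<le> p" by linarith
  then show thesis
  proof cases
    case 1
    show ?thesis
      by (rule that[OF _ T(2)], unfold_locales) (use T(1) d 1 acute in simp_all)
  next
    case 2
    show ?thesis
      by (rule that[OF _ hull(1)], unfold_locales) (use nc d 2 acute in simp_all)
  next
    case 3
    show ?thesis
      by (rule that[OF _ hull(2)], unfold_locales) (use nc d 3 acute' in simp_all)
  next
    case 4
    show ?thesis
      by (rule that[OF _ hull(3)], unfold_locales) (use nc d 4 acute in simp_all)
  next
    case 5
    show ?thesis
      by (rule that[OF _ hull(4)], unfold_locales) (use nc d 5 acute' in simp_all)
  next
    case 6
    show ?thesis
      by (rule that[OF _ hull(5)], unfold_locales) (use nc d 6 acute' in simp_all)
  qed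
qed

theorem theorem3:
  fixes T :: "plane set"
  assumes "acute_triangle T"
  shows "\<not> (\<exists>f. space_filling_curve T f \<and> face_continuous T f \<and> based_on_reptiling T f)"
proof
  assume "\<exists>f. space_filling_curve T f \<and> face_continuous T f \<and> based_on_reptiling T f"
  then obtain f where f: "face_continuous T f" "based_on_reptiling T f" by blast
  then obtain \<T> G r where construction: "gentiling_construction T f \<T> G" "reptiling r T (\<T> 0)"
    "\<forall>i. \<forall>t\<in>\<T> i. reptiling r t (G i t)"
    unfolding based_on_reptiling_def by blast
  obtain A B C where ABC: "sorted_acute_triangle A B C" "T = convex hull {A, B, C}"
    using acute_triangle_sorted[OF assms] .
  then interpret sorted_acute_triangle A B C by simp
  have "reptiling_curve A B C f \<T> G r"
    by unfold_locales (use f construction ABC(2) in auto)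
  then show False by (rule reptiling_curve.no_reptiling_curve)
qed

end
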